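(* Let $Y_0$ be a closed $K$-orbit on $G/B$ and $Q=(j_1,\ldots,j_N)$ a word. Then $\mathcal{BEM}^{Y_0,Q}$ is stratified by closed subvarieties, with strata indexed by the subwords $P$ of $Q$: the stratum corresponding to $P=(\beta_1,\ldots,\beta_N)$ is $$\mathcal{S}(P)=\{(x_{N+1},\ldots,x_1)\in\mathcal{BEM}^{Y_0,Q}\mid x_i=x_{i+1}\text{ if }\beta_i=-\}.$$ Moreover, $\mathcal{S}(P)$ is canonically isomorphic (via the projection deleting every component $x_i$ with $\beta_i=-$) to $\mathcal{BEM}^{Y_0,\mathrm{flat}(P)}$, where $\mathrm{flat}(P)$ is the word obtained from $P$ by deleting all symbols $-$.
   Context: Setting: $G$ is a connected reductive complex algebraic group, $\theta$ is an involution of $G$, $B\subseteq G$ is a $\theta$-stable Borel subgroup containing a $\theta$-stable maximal torus $T$, and $K=G^\theta$, assumed connected, acts on $G/B$ by left multiplication. $\alpha_1,\ldots,\alpha_r$ are the simple roots corresponding to $B$, $s_1,\ldots,s_r$ the simple reflections, and $P_i=B\cup Bs_iB$ the minimal parabolic subgroups. A word is a tuple $Q=(j_1,\ldots,j_N)$ of elements of $\{1,\ldots,r\}$ (not necessarily reduced). A subword of $Q$ is a list $P=(\beta_1,\ldots,\beta_N)$ with $\beta_i\in\{-,j_i\}$ for each $i$. The Barbasch-Evens-Magyar variety $\mathcal{BEM}^{Y_0,Q}:=Y_0\times_{G/P_{j_N}}G/B\times_{G/P_{j_{N-1}}}\cdots\times_{G/P_{j_1}}G/B$ is the set of $(x_{N+1},x_N,\ldots,x_1)\in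 Y_0\times (G/B)^N$ such that $x_{i+1}$ and $x_i$ have the same image in $G/P_{j_i}$ for $i=1,\ldots,N$. For the empty word it is $Y_0$. A stratification by closed subvarieties of a variety $X$ is a decomposition $X=\bigcup_\xi \mathcal{S}_\xi$ into closed subvarieties such that the intersection of any two closed strata is a union of strata. *)

theory Defs
  imports "HOL-Analysis.Analysis" "HOL-Algebra.Coset"
    "HOL-Algebra.Solvable_Groups" "HOL-Algebra.Group_Action"
begin

section \<open>Complex varieties as spaces with functions\<close>

text \<open>
  Varieties over the complex numbers are treated classically, as topological spaces equipped with
  a sheaf of complex-valued functions (Springer, Kempf): \<open>reg X U\<close> is the set of regular functions
  on the open set \<open>U\<close>. A function is a total function in HOL; all the constructions below make
  membership in \<open>reg X U\<close> depend only on its values on \<open>U\<close>.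
\<close>

record 'a fspace =
  zar :: "'a topology"
  reg :: "'a set \<Rightarrow> ('a \<Rightarrow> complex) set"

abbreviation points :: "'a fspace \<Rightarrow> 'a set" where
  "points X \<equiv> topspace (zar X)"

definition morphism :: "'a fspace \<Rightarrow> 'b fspace \<Rightarrow> ('a \<Rightarrow> 'b) \<Rightarrow> bool" where
  "morphism X Y \<phi> \<longleftrightarrow> continuous_map (zar X) (zar Y) \<phi> \<and>
     (\<forall>V f. openin (zar Y) V \<and> f \<in> reg Y V \<longrightarrow> f \<circ> \<phi> \<in> reg X {x \<in> points X. \<phi> x \<in> V})"

definition isomorphism :: "'a fspace \<Rightarrow> 'b fspace \<Rightarrow> ('a \<Rightarrow> 'b) \<Rightarrow> bool" where
  "isomorphism X Y \<phi> \<longleftrightarrow> morphism X Y \<phi> \<and>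
     (\<exists>\<psi>. morphism Y X \<psi> \<and> (\<forall>x\<in>points X. \<psi> (\<phi> x) = x) \<and> (\<forall>y\<in>points Y. \<phi> (\<psi> y) = y))"

inductive_set generated_algebra :: "('a \<Rightarrow> complex) set \<Rightarrow> ('a \<Rightarrow> complex) set"
  for F :: "('a \<Rightarrow> complex) set" where
  gen: "f \<in> F \<Longrightarrow> f \<in> generated_algebra F"
| const: "(\<lambda>_. c) \<in> generated_algebra F"
| add: "f \<in> generated_algebra F \<Longrightarrow> g \<in> generated_algebra F \<Longrightarrow> (\<lambda>x. f x + g x) \<in> generated_algebra F"
| mult: "f \<in> generated_algebra F \<Longrightarrow> g \<in> generated_algebra F \<Longrightarrow> (\<lambda>x. f x * g x) \<in> generated_algebra F"

text \<open>The locus \<open>A\<close> inside an affine space with coordinate functions \<open>F\<close>: the basic open sets are the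
  non-vanishing loci of polynomials, regular functions are locally quotients of polynomials.\<close>

definition affine_locus :: "'a set \<Rightarrow> ('a \<Rightarrow> complex) set \<Rightarrow> 'a fspace" where
  "affine_locus A F = \<lparr>
     zar = topology_generated_by {{x \<in> A. p x \<noteq> 0} | p. p \<in> generated_algebra F},
     reg = (\<lambda>U. {f. \<forall>x\<in>U. \<exists>p\<in>generated_algebra F. \<exists>q\<in>generated_algebra F.
                  q x \<noteq> 0 \<and> (\<forall>y\<in>U. q y \<noteq> 0 \<longrightarrow> f y = p y / q y)}) \<rparr>"

text \<open>The subset \<open>Z\<close> with the subspace topology and the (reduced) induced structure: functions that are
  locally restrictions of regular functions of the ambient space.\<close>

definition induced :: "'a fspace \<Rightarrow> 'a set \<Rightarrow> 'a fspace" where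
  "induced X Z = \<lparr>
     zar = subtopology (zar X) Z,
     reg = (\<lambda>U. {f. \<forall>x\<in>U. \<exists>V g. openin (zar X) V \<and> x \<in> V \<and> g \<in> reg X V \<and>
                  (\<forall>y\<in>U \<inter> V. f y = g y)}) \<rparr>"

definition quotient_variety :: "'a fspace \<Rightarrow> ('a \<Rightarrow> 'b) \<Rightarrow> 'b fspace" where
  "quotient_variety X \<pi> = \<lparr>
     zar = topology_generated_by {V. V \<subseteq> \<pi> ` points X \<and> openin (zar X) {x \<in> points X. \<pi> x \<in> V}},
     reg = (\<lambda>V. {f. f \<circ> \<pi> \<in> reg X {x \<in> points X. \<pi> x \<in> V}}) \<rparr>"

text \<open>The product of finitely many varieties, i.e. the categorical product of spaces with functions
  (this is finer than the product topology): for open \<open>U i\<close>, the algebra \<open>product_functions X I U\<close>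
  consists of the sums of products of regular functions on the \<open>U i\<close>; basic open sets are the
  non-vanishing loci of its members, regular functions are locally quotients of its members.\<close>

definition product_functions ::
  "('i \<Rightarrow> 'a fspace) \<Rightarrow> 'i set \<Rightarrow> ('i \<Rightarrow> 'a set) \<Rightarrow> (('i \<Rightarrow> 'a) \<Rightarrow> complex) set" where
  "product_functions X I U = generated_algebra {\<lambda>x. f (x i) | i f. i \<in> I \<and> f \<in> reg (X i) (U i)}"

definition product_variety :: "'i set \<Rightarrow> ('i \<Rightarrow> 'a fspace) \<Rightarrow> ('i \<Rightarrow> 'a) fspace" where
  "product_variety I X = \<lparr>
     zar = topology_generated_by
       {{x \<in> Pi\<^sub>E I U. h x \<noteq> 0} | U h.
          (\<forall>i\<in>I. openin (zar (X i)) (U i)) \<and> h \<in> product_functions X I U},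
     reg = (\<lambda>W. {f. \<forall>x\<in>W. \<exists>U. (\<forall>i\<in>I. openin (zar (X i)) (U i)) \<and> x \<in> Pi\<^sub>E I U \<and>
                  (\<exists>p\<in>product_functions X I U. \<exists>q\<in>product_functions X I U. q x \<noteq> 0 \<and>
                     (\<forall>y\<in>W \<inter> Pi\<^sub>E I U. q y \<noteq> 0 \<longrightarrow> f y = p y / q y))}) \<rparr>"

text \<open>A closed subvariety is a closed subset (with the induced structure; not necessarily irreducible).\<close>

definition stratification_by_closed_subvarieties ::
  "'a fspace \<Rightarrow> 'i set \<Rightarrow> ('i \<Rightarrow> 'a set) \<Rightarrow> bool" where
  "stratification_by_closed_subvarieties X I S \<longleftrightarrow>
     points X = (\<Union>\<xi>\<in>I. S \<xi>) \<and>
     (\<forall>\<xi>\<in>I. closedin (zar X) (S \<xi>)) \<and>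
     (\<forall>\<xi>\<in>I. \<forall>\<eta>\<in>I. \<exists>J\<subseteq>I. S \<xi> \<inter> S \<eta> = (\<Union>\<zeta>\<in>J. S \<zeta>))"

section \<open>Linear algebraic groups\<close>

type_synonym 'n mat = "complex ^ 'n ^ 'n"

definition GL :: "('n::finite) mat monoid" where
  "GL = \<lparr>carrier = {g. invertible g}, monoid.mult = (**), one = mat 1\<rparr>"

abbreviation grp :: "('n::finite) mat set \<Rightarrow> 'n mat monoid" where
  "grp H \<equiv> GL\<lparr>carrier := H\<rparr>"

definition matrix_entries :: "(('n::finite) mat \<Rightarrow> complex) set" where
  "matrix_entries = {\<lambda>g. g $ i $ j | i j. True}"

definition GL_variety :: "('n::finite) mat fspace" where
  "GL_variety = affine_locus {g. invertible g} matrix_entries"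

abbreviation var :: "('n::finite) mat set \<Rightarrow> 'n mat fspace" where
  "var H \<equiv> induced GL_variety H"

definition algebraic_group :: "('n::finite) mat set \<Rightarrow> bool" where
  "algebraic_group H \<longleftrightarrow> subgroup H GL \<and> closedin (zar GL_variety) H"

definition connected_algebraic_group :: "('n::finite) mat set \<Rightarrow> bool" where
  "connected_algebraic_group H \<longleftrightarrow> algebraic_group H \<and> connected_space (zar (var H))"

definition unipotent :: "('n::finite) mat \<Rightarrow> bool" where
  "unipotent g \<longleftrightarrow> (\<exists>k::nat. ((\<lambda>M. (g - mat 1) ** M) ^^ k) (mat 1) = 0)"

text \<open>Reductive: trivial unipotent radical.\<close>

definition connected_reductive :: "('n::finite) mat set \<Rightarrow> bool" where
  "connected_reductive G \<longleftrightarrow> connected_algebraic_group G \<and>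
     (\<forall>U. connected_algebraic_group U \<and> U \<lhd> grp G \<and> (\<forall>u\<in>U. unipotent u) \<longrightarrow> U = {mat 1})"

definition algebraic_involution :: "('n::finite) mat set \<Rightarrow> ('n mat \<Rightarrow> 'n mat) \<Rightarrow> bool" where
  "algebraic_involution G \<theta> \<longleftrightarrow>
     \<theta> \<in> hom (grp G) (grp G) \<and> morphism (var G) (var G) \<theta> \<and> (\<forall>g\<in>G. \<theta> (\<theta> g) = g)"

definition fixed_subgroup :: "('n::finite) mat set \<Rightarrow> ('n mat \<Rightarrow> 'n mat) \<Rightarrow> 'n mat set" where
  "fixed_subgroup G \<theta> = {g \<in> G. \<theta> g = g}"

definition connected_solvable_subgroups :: "('n::finite) mat set \<Rightarrow> 'n mat set set" where
  "connected_solvable_subgroups G = {H. H \<subseteq> G \<and> connected_algebraic_group H \<and> solvable (grp H)}"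

definition borel_subgroup :: "('n::finite) mat set \<Rightarrow> 'n mat set \<Rightarrow> bool" where
  "borel_subgroup G B \<longleftrightarrow> B \<in> connected_solvable_subgroups G \<and>
     (\<forall>H\<in>connected_solvable_subgroups G. B \<subseteq> H \<longrightarrow> H = B)"

definition Gm_power :: "nat \<Rightarrow> (nat \<Rightarrow> complex) monoid" where
  "Gm_power k = \<lparr>carrier = {..<k} \<rightarrow>\<^sub>E (UNIV - {0}),
     monoid.mult = (\<lambda>x y. \<lambda>i\<in>{..<k}. x i * y i), one = (\<lambda>i\<in>{..<k}. 1)\<rparr>"

definition Gm_power_variety :: "nat \<Rightarrow> (nat \<Rightarrow> complex) fspace" where
  "Gm_power_variety k = affine_locus (carrier (Gm_power k)) {\<lambda>x. x i | i. i < k}"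

definition torus :: "('n::finite) mat set \<Rightarrow> bool" where
  "torus T \<longleftrightarrow> algebraic_group T \<and>
     (\<exists>k \<phi>. \<phi> \<in> iso (grp T) (Gm_power k) \<and> isomorphism (var T) (Gm_power_variety k) \<phi>)"

definition maximal_torus :: "('n::finite) mat set \<Rightarrow> 'n mat set \<Rightarrow> bool" where
  "maximal_torus G T \<longleftrightarrow> torus T \<and> T \<subseteq> G \<and> (\<forall>T'. torus T' \<and> T' \<subseteq> G \<and> T \<subseteq> T' \<longrightarrow> T' = T)"

section \<open>Roots, simple reflections and minimal parabolic subgroups\<close>

definition mat_scale :: "complex \<Rightarrow> ('n::finite) mat \<Rightarrow> 'n mat" where
  "mat_scale c X = (\<chi> i j. c * X $ i $ j)"

text \<open>The Lie algebra is the tangent space at the identity, on which the group acts by conjugation.\<close>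

definition lie_algebra :: "('n::finite) mat set \<Rightarrow> 'n mat set" where
  "lie_algebra H = {X. \<forall>p\<in>generated_algebra matrix_entries.
     (\<forall>h\<in>H. p h = 0) \<longrightarrow> deriv (\<lambda>t. p (mat 1 + mat_scale t X)) 0 = 0}"

text \<open>The nonzero weights of \<open>T\<close> on the Lie algebra of \<open>H\<close>, written multiplicatively. An \<open>\<alpha>\<close> with a
  nonzero weight vector is automatically an algebraic character of \<open>T\<close>.\<close>

definition roots :: "('n::finite) mat set \<Rightarrow> 'n mat set \<Rightarrow> ('n mat \<Rightarrow> complex) set" where
  "roots H T = {\<alpha> \<in> extensional T. (\<exists>t\<in>T. \<alpha> t \<noteq> 1) \<and>
     (\<exists>X\<in>lie_algebra H. X \<noteq> 0 \<and> (\<forall>t\<in>T. t ** X ** matrix_inv t = mat_scale (\<alpha> t) X))}"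

text \<open>The positive roots determined by \<open>B\<close> are \<open>roots B T\<close>; the simple ones are those that are not a sum
  of two positive roots.\<close>

definition simple_roots :: "('n::finite) mat set \<Rightarrow> 'n mat set \<Rightarrow> ('n mat \<Rightarrow> complex) set" where
  "simple_roots B T = {\<alpha> \<in> roots B T.
     \<not> (\<exists>\<beta>\<in>roots B T. \<exists>\<gamma>\<in>roots B T. \<forall>t\<in>T. \<alpha> t = \<beta> t * \<gamma> t)}"

definition weyl_group :: "('n::finite) mat set \<Rightarrow> 'n mat set \<Rightarrow> 'n mat set monoid" where
  "weyl_group G T = grp (normalizer (grp G) T) Mod T"

definition ker_identity_component :: "('n::finite) mat set \<Rightarrow> ('n mat \<Rightarrow> complex) \<Rightarrow> 'n mat set" where
  "ker_identity_component T \<alpha> = connected_component_of_set (zar (var {t \<in> T. \<alpha> t = 1})) (mat 1)"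

definition rank_one_subgroup ::
  "('n::finite) mat set \<Rightarrow> 'n mat set \<Rightarrow> ('n mat \<Rightarrow> complex) \<Rightarrow> 'n mat set" where
  "rank_one_subgroup G T \<alpha> = {g \<in> G. \<forall>t\<in>ker_identity_component T \<alpha>. g ** t = t ** g}"

text \<open>The reflection in the root \<open>\<alpha>\<close> is the nontrivial element of the Weyl group (of order two) of the
  centralizer of the identity component of the kernel of \<open>\<alpha>\<close>. As an element of the Weyl group of \<open>G\<close>,
  it is a coset of \<open>T\<close>, i.e. a set of matrices.\<close>

definition reflection ::
  "('n::finite) mat set \<Rightarrow> 'n mat set \<Rightarrow> ('n mat \<Rightarrow> complex) \<Rightarrow> 'n mat set" where
  "reflection G T \<alpha> = (let W = weyl_group (rank_one_subgroup G T \<alpha>) T in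
     THE s. s \<in> carrier W \<and> s \<noteq> one W)"

definition minimal_parabolic ::
  "('n::finite) mat set \<Rightarrow> 'n mat set \<Rightarrow> 'n mat set \<Rightarrow> ('n mat \<Rightarrow> complex) \<Rightarrow> 'n mat set" where
  "minimal_parabolic G B T \<alpha> = B \<union> (B <#>\<^bsub>GL\<^esub> reflection G T \<alpha> <#>\<^bsub>GL\<^esub> B)"

section \<open>The flag variety and its K-orbits\<close>

definition flag_variety :: "('n::finite) mat set \<Rightarrow> 'n mat set \<Rightarrow> 'n mat set fspace" where
  "flag_variety G B = quotient_variety (var G) (\<lambda>g. g <#\<^bsub>GL\<^esub> B)"

definition closed_orbit ::
  "('n::finite) mat set \<Rightarrow> 'n mat set \<Rightarrow> 'n mat set \<Rightarrow> 'n mat set set \<Rightarrow> bool" where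
  "closed_orbit K G B Y \<longleftrightarrow>
     (\<exists>x\<in>points (flag_variety G B). Y = {k <#\<^bsub>GL\<^esub> x | k. k \<in> K}) \<and>
     closedin (zar (flag_variety G B)) Y"

section \<open>Barbasch-Evens-Magyar varieties\<close>

text \<open>A word \<open>(j\<^sub>1, \<dots>, j\<^sub>N)\<close> is the list \<open>Q\<close> with \<open>j\<^sub>i = Q ! (i - 1)\<close>. The tuple
  \<open>(x\<^sub>N\<^sub>+\<^sub>1, \<dots>, x\<^sub>1)\<close> is the function \<open>x\<close> on \<open>{1..N+1}\<close> with \<open>x i = x\<^sub>i\<close>. The image of
  the coset \<open>gB\<close> in \<open>G/P\<close> is the coset \<open>gP = (gB)P\<close>. The parameter \<open>Par j\<close> is the parabolic attached to
  the letter \<open>j\<close>.\<close>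

definition BEM_ambient ::
  "('n::finite) mat set \<Rightarrow> 'n mat set \<Rightarrow> 'n mat set set \<Rightarrow> nat \<Rightarrow> (nat \<Rightarrow> 'n mat set) fspace" where
  "BEM_ambient G B Y N = product_variety {1..N+1}
     (\<lambda>i. if i = N + 1 then induced (flag_variety G B) Y else flag_variety G B)"

definition BEM_set ::
  "('n::finite) mat set \<Rightarrow> 'n mat set \<Rightarrow> (nat \<Rightarrow> 'n mat set) \<Rightarrow> 'n mat set set \<Rightarrow> nat list
     \<Rightarrow> (nat \<Rightarrow> 'n mat set) set" where
  "BEM_set G B Par Y Q = {x \<in> points (BEM_ambient G B Y (length Q)).
     \<forall>i\<in>{1..length Q}. x (i + 1) <#>\<^bsub>GL\<^esub> Par (Q ! (i - 1)) = x i <#>\<^bsub>GL\<^esub> Par (Q ! (i - 1))}"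

definition BEM ::
  "('n::finite) mat set \<Rightarrow> 'n mat set \<Rightarrow> (nat \<Rightarrow> 'n mat set) \<Rightarrow> 'n mat set set \<Rightarrow> nat list
     \<Rightarrow> (nat \<Rightarrow> 'n mat set) fspace" where
  "BEM G B Par Y Q = induced (BEM_ambient G B Y (length Q)) (BEM_set G B Par Y Q)"

text \<open>In a subword, \<open>None\<close> stands for the symbol \<open>-\<close>.\<close>

definition subwords :: "nat list \<Rightarrow> nat option list set" where
  "subwords Q = {P. length P = length Q \<and> (\<forall>i<length Q. P ! i \<in> {None, Some (Q ! i)})}"

definition flat :: "nat option list \<Rightarrow> nat list" where
  "flat P = map the (filter (\<lambda>\<beta>. \<beta> \<noteq> None) P)"

definition stratum ::
  "('n::finite) mat set \<Rightarrow> 'n mat set \<Rightarrow> (nat \<Rightarrow> 'n mat set) \<Rightarrow> 'n mat set set \<Rightarrow> nat list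
     \<Rightarrow> nat option list \<Rightarrow> (nat \<Rightarrow> 'n mat set) set" where
  "stratum G B Par Y Q P = {x \<in> points (BEM G B Par Y Q).
     \<forall>i\<in>{1..length Q}. P ! (i - 1) = None \<longrightarrow> x i = x (i + 1)}"

definition kept_positions :: "nat option list \<Rightarrow> nat list" where
  "kept_positions P = filter (\<lambda>i. P ! (i - 1) \<noteq> None) [1..<length P + 1] @ [length P + 1]"

text \<open>Deletion of the components \<open>x\<^sub>i\<close> with \<open>\<beta>\<^sub>i = -\<close>; the remaining ones are renumbered from \<open>1\<close>,
  in the same order.\<close>

definition delete_components :: "nat option list \<Rightarrow> (nat \<Rightarrow> 'b) \<Rightarrow> nat \<Rightarrow> 'b" where
  "delete_components P x = (\<lambda>k\<in>{1..length (flat P) + 1}. x (kept_positions P ! (k - 1)))"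

end

theory Submission
  imports Defs "HOL-Library.Function_Algebras" "Jordan_Normal_Form.Determinant"
begin

text \<open>
  The points of the variety are tuples of cosets, and the stratum of \<open>P\<close> is cut out by the equations
  \<open>x i = x (i + 1)\<close> at the positions with the symbol \<open>-\<close>. Hence the word itself gives the whole variety,
  intersections of strata are obtained by taking the union of the sets of equations, and a tuple in the stratum is
  determined by its remaining components, which satisfy exactly the incidence conditions of
  \<open>flat P\<close>. The deletion of components and its inverse, which repeats components, are morphisms since
  they only rearrange the factors of a product (\<open>morphism_reindex\<close>, \<open>stratum_isomorphism\<close>).

  The geometric content is that the strata are closed, i.e. that the diagonal of
  \<open>G/B \<times> G/B\<close> is closed in the Zariski topology of the product variety, which is generated by
  non-vanishing loci of sums of products of local regular functions. So for \<open>g B \<noteq> h B\<close> one has to find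
  regular functions on open subsets of \<open>G/B\<close> that tell the two cosets apart. They are quotients of polynomials
  \<open>F\<close> on the group that are semi-invariant, \<open>F (x b) = F x * \<eta> b\<close>, with the same character \<open>\<eta>\<close>
  (\<open>flag_variety_fraction\<close>, \<open>flag_variety_separated\<close>).

  The construction of semi-invariants (\<open>semi_invariants_separating_cosets\<close>) is that of Chevalley's theorem on
  quotients, made explicit. As \<open>B\<close> is closed, some polynomial \<open>p\<close> vanishes on \<open>B\<close> but not
  at \<open>g\<inverse> h\<close>. It lies in a finite-dimensional space \<open>W\<close> of polynomials that is stable under left
  translation (\<open>left_translates_span_finite\<close>). Choosing points \<open>a i\<close> of \<open>B\<close> at which the evaluations form
  a basis of the functionals on \<open>W\<close> given by \<open>B\<close> (\<open>dual_bases_on_set\<close>), the determinants of the matrices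
  \<open>\<psi> j (x a i)\<close> with \<open>\<psi> j \<in> W\<close> are semi-invariant, all with the same character, and a suitable choice
  of the \<open>\<psi> j\<close> separates \<open>g B\<close> from \<open>h B\<close>. Only two given cosets have to be separated at a
  time, so \<open>W\<close> may depend on them.
\<close>

hide_type (open) Matrix.mat
hide_const (open) Matrix.mat Determinant.det
no_notation Matrix.vec_index (infixl "$" 100)

section \<open>Generated algebras and affine loci\<close>

lemma generated_algebra_sum:
  assumes "\<And>i. i \<in> I \<Longrightarrow> f i \<in> generated_algebra F"
  shows "(\<lambda>x. \<Sum>i\<in>I. f i x) \<in> generated_algebra F"
  using assms
  by (induction I rule: infinite_finite_induct)
    (simp_all add: generated_algebra.const generated_algebra.add)

lemma generated_algebra_prod:
  assumes "\<And>i. i \<in> I \<Longrightarrow> f i \<in> generated_algebra F"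
  shows "(\<lambda>x. \<Prod>i\<in>I. f i x) \<in> generated_algebra F"
  using assms
  by (induction I rule: infinite_finite_induct)
    (simp_all add: generated_algebra.const generated_algebra.mult)

lemma generated_algebra_comp:
  assumes "f \<in> generated_algebra F"
    and "\<And>f. f \<in> F \<Longrightarrow> (\<lambda>x. f (\<phi> x)) \<in> generated_algebra F'"
  shows "(\<lambda>x. f (\<phi> x)) \<in> generated_algebra F'"
  using assms(1)
  by induction (simp_all add: assms(2) generated_algebra.const generated_algebra.add generated_algebra.mult)

text \<open>
  The non-vanishing loci of polynomials are closed under finite intersections, since
  \<open>p x * q x \<noteq> 0\<close> means that both factors are nonzero; so they form a basis and not merely a subbasis.
\<close>

lemma openin_affine_locus_iff:
  "openin (zar (affine_locus A F)) U \<longleftrightarrow>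
     U \<subseteq> A \<and> (\<forall>x\<in>U. \<exists>p\<in>generated_algebra F. p x \<noteq> 0 \<and> {y \<in> A. p y \<noteq> 0} \<subseteq> U)"
    (is "?L \<longleftrightarrow> ?R")
proof (rule iffI)
  let ?B = "{{x \<in> A. p x \<noteq> 0} | p. p \<in> generated_algebra F}"
  assume ?L
  then have "generate_topology_on ?B U"
    by (simp add: affine_locus_def openin_topology_generated_by_iff)
  then show ?R
  proof (induction rule: generate_topology_on.induct)
    case Empty
    show ?case by simp
  next
    case (Int a b)
    show ?case
    proof (intro conjI ballI)
      show "a \<inter> b \<subseteq> A" using Int.IH by blast
    next
      fix x assume "x \<in> a \<inter> b"
      then have x: "x \<in> a" "x \<in> b" by auto
      obtain p where p: "p \<in> generated_algebra F" "p x \<noteq> 0" "{y \<in> A. p y \<noteq> 0} \<subseteq> a"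
        using bspec[OF conjunct2[OF Int.IH(1)] x(1)] by (elim bexE conjE)
      obtain q where q: "q \<in> generated_algebra F" "q x \<noteq> 0" "{y \<in> A. q y \<noteq> 0} \<subseteq> b"
        using bspec[OF conjunct2[OF Int.IH(2)] x(2)] by (elim bexE conjE)
      have "(\<lambda>x. p x * q x) \<in> generated_algebra F"
        using p q by (intro generated_algebra.mult)
      moreover have "{y \<in> A. p y * q y \<noteq> 0} \<subseteq> a \<inter> b"
        using p(3) q(3) by auto
      ultimately show "\<exists>p\<in>generated_algebra F. p x \<noteq> 0 \<and> {y \<in> A. p y \<noteq> 0} \<subseteq> a \<inter> b"
        using p(2) q(2) by (intro bexI[of _ "\<lambda>x. p x * q x"]) auto
    qed
  next
    case (UN K)
    show ?case
    proof (intro conjI ballI)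
      show "\<Union> K \<subseteq> A" using UN.IH by blast
    next
      fix x assume "x \<in> \<Union> K"
      then obtain k where k: "k \<in> K" "x \<in> k" by blast
      then obtain p where "p \<in> generated_algebra F" "p x \<noteq> 0" "{y \<in> A. p y \<noteq> 0} \<subseteq> k"
        using bspec[OF conjunct2[OF UN.IH[OF k(1)]] k(2)] by (elim bexE conjE)
      moreover from this(3) have "{y \<in> A. p y \<noteq> 0} \<subseteq> \<Union> K"
        using k(1) by blast
      ultimately show "\<exists>p\<in>generated_algebra F. p x \<noteq> 0 \<and> {y \<in> A. p y \<noteq> 0} \<subseteq> \<Union> K"
        by (intro bexI[of _ p] conjI)
    qed
  next
    case (Basis s)
    then obtain p where "p \<in> generated_algebra F" "s = {x \<in> A. p x \<noteq> 0}" by blast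
    then show ?case by (simp add: bexI[of _ p])
  qed
next
  assume R: ?R
  have "\<exists>V. openin (zar (affine_locus A F)) V \<and> x \<in> V \<and> V \<subseteq> U" if "x \<in> U" for x
  proof -
    obtain p where p: "p \<in> generated_algebra F" "p x \<noteq> 0" "{y \<in> A. p y \<noteq> 0} \<subseteq> U"
      using R \<open>x \<in> U\<close> by blast
    have "openin (zar (affine_locus A F)) {y \<in> A. p y \<noteq> 0}"
      unfolding affine_locus_def fspace.select_convs
      by (rule topology_generated_by_Basis, rule CollectI, rule exI[of _ p], simp add: p(1))
    moreover have "x \<in> {y \<in> A. p y \<noteq> 0}" using R p(2) that by blast
    ultimately show ?thesis using p(3) by meson
  qed
  then show ?L using openin_subopen[of "zar (affine_locus A F)" U] by blast
qed

lemma points_affine_locus: "points (affine_locus A F) = A"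
proof (rule equalityI)
  have "openin (zar (affine_locus A F)) (points (affine_locus A F))" by (rule openin_topspace)
  then show "points (affine_locus A F) \<subseteq> A" unfolding openin_affine_locus_iff by (rule conjunct1)
  have "\<exists>p\<in>generated_algebra F. p x \<noteq> 0 \<and> {y \<in> A. p y \<noteq> 0} \<subseteq> A" for x
    by (rule bexI[OF _ generated_algebra.const[of 1]]) simp
  then have "openin (zar (affine_locus A F)) A"
    unfolding openin_affine_locus_iff by simp
  then show "A \<subseteq> points (affine_locus A F)"
    by (rule openin_subset)
qed

section \<open>Finite-dimensional spaces of functions\<close>

interpretation function_space: vector_space "\<lambda>c (f :: 'a \<Rightarrow> complex) x. c * f x"
  by unfold_locales (auto simp: fun_eq_iff algebra_simps)

text \<open>
  By bilinearity of the product; hence the products of the members of two finite-dimensional spaces lie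
  in a finite-dimensional space.
\<close>

lemma function_space_span_mult:
  assumes "f \<in> function_space.span S" and "g \<in> function_space.span T"
  shows "(\<lambda>x. f x * g x) \<in> function_space.span {\<lambda>x. s x * t x | s t. s \<in> S \<and> t \<in> T}"
    (is "_ \<in> ?W")
proof -
  have *: "(\<lambda>x. s x * g x) \<in> ?W" if "s \<in> S" for s
    using assms(2)
  proof (induction rule: function_space.span_induct_alt)
    case base
    show ?case using function_space.span_zero by (simp add: zero_fun_def)
  next
    case (step c t g)
    have "(\<lambda>x. s x * t x) \<in> ?W"
      using step(1) \<open>s \<in> S\<close> by (intro function_space.span_base) blast
    then have "(\<lambda>x. c * (s x * t x)) + (\<lambda>x. s x * g x) \<in> ?W"
      by (intro function_space.span_add[OF _ step(2)] function_space.span_scale)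
    then show ?case by (simp add: plus_fun_def algebra_simps)
  qed
  show ?thesis
    using assms(1)
  proof (induction rule: function_space.span_induct_alt)
    case base
    show ?case using function_space.span_zero by (simp add: zero_fun_def)
  next
    case (step c s f)
    have "(\<lambda>x. c * (s x * g x)) + (\<lambda>x. f x * g x) \<in> ?W"
      by (intro function_space.span_add[OF _ step(2)] function_space.span_scale *[OF step(1)])
    then show ?case by (simp add: plus_fun_def algebra_simps)
  qed
qed

text \<open>
  The restriction to \<open>X\<close> of a finite-dimensional space of functions is coordinatised by evaluation at
  finitely many points \<open>a i\<close> of \<open>X\<close>: the \<open>\<phi> i\<close> are the basis dual to these evaluations. The induction
  adds one spanning function \<open>\<psi>\<close> at a time. Subtracting its interpolation at the present points leaves a
  function \<open>\<rho>\<close> vanishing there; either \<open>\<rho>\<close> vanishes on all of \<open>X\<close>, or a point \<open>z\<close> with \<open>\<rho> z \<noteq> 0\<close>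
  becomes the next point and a multiple of \<open>\<rho>\<close> the next dual function.
\<close>

lemma dual_bases_on_set:
  fixes T :: "('a \<Rightarrow> complex) set"
  assumes "finite T"
  shows "\<exists>(m::nat) \<phi> a. (\<forall>i<m. \<phi> i \<in> function_space.span T \<and> a i \<in> X) \<and>
    (\<forall>i<m. \<forall>j<m. \<phi> i (a j) = (if i = j then 1 else 0)) \<and>
    (\<forall>f\<in>function_space.span T. \<forall>x\<in>X. f x = (\<Sum>i<m. f (a i) * \<phi> i x))"
  using assms
proof (induction T)
  case empty
  show ?case by (rule exI[of _ 0]) auto
next
  case (insert \<psi> T)
  obtain m :: nat and \<phi> a where
    *: "(\<forall>i<m. \<phi> i \<in> function_space.span T \<and> a i \<in> X) \<and>
      (\<forall>i<m. \<forall>j<m. \<phi> i (a j) = (if i = j then 1 else 0)) \<and>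
      (\<forall>f\<in>function_space.span T. \<forall>x\<in>X. f x = (\<Sum>i<m. f (a i) * \<phi> i x))"
    using insert.IH by (elim exE)
  have \<phi>: "\<And>i. i < m \<Longrightarrow> \<phi> i \<in> function_space.span T" and a: "\<And>i. i < m \<Longrightarrow> a i \<in> X"
    and dual: "\<And>i j. i < m \<Longrightarrow> j < m \<Longrightarrow> \<phi> i (a j) = (if i = j then 1 else 0)"
    and rep: "\<And>f x. f \<in> function_space.span T \<Longrightarrow> x \<in> X \<Longrightarrow> f x = (\<Sum>i<m. f (a i) * \<phi> i x)"
    using * by simp_all
  let ?W = "function_space.span (insert \<psi> T)"
  have TW: "f \<in> ?W" if "f \<in> function_space.span T" for f
    using that function_space.span_mono[of T "insert \<psi> T"] by blast
  have split: "\<exists>c g. g \<in> function_space.span T \<and> f = (\<lambda>x. c * \<psi> x + g x)" if "f \<in> ?W" for f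
  proof -
    obtain c where "f - (\<lambda>x. c * \<psi> x) \<in> function_space.span T"
      using \<open>f \<in> ?W\<close> unfolding function_space.span_breakdown_eq by (elim exE)
    then show ?thesis
      by (intro exI[of _ c] exI[of _ "f - (\<lambda>x. c * \<psi> x)"]) auto
  qed
  define \<rho> where "\<rho> = (\<lambda>x. \<psi> x - (\<Sum>i<m. \<psi> (a i) * \<phi> i x))"
  have "\<psi> - (\<Sum>i<m. (\<lambda>x. \<psi> (a i) * \<phi> i x)) \<in> ?W"
  proof (rule function_space.span_diff)
    show "\<psi> \<in> ?W" by (rule function_space.span_base) simp
    show "(\<Sum>i<m. (\<lambda>x. \<psi> (a i) * \<phi> i x)) \<in> ?W"
      by (intro function_space.span_sum function_space.span_scale TW \<phi>) simp
  qed
  moreover have "\<psi> - (\<Sum>i<m. (\<lambda>x. \<psi> (a i) * \<phi> i x)) = \<rho>"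
  proof -
    have "(\<Sum>i<m. (\<lambda>x. \<psi> (a i) * \<phi> i x)) x = (\<Sum>i<m. \<psi> (a i) * \<phi> i x)" for x
      by (induction m) auto
    then show ?thesis by (auto simp: \<rho>_def fun_eq_iff)
  qed
  ultimately have \<rho>W: "\<rho> \<in> ?W" by simp
  have \<rho>0: "\<rho> (a j) = 0" if "j < m" for j
    using that by (simp add: \<rho>_def dual if_distrib[of "\<lambda>z. _ * z"] cong: if_cong)
  show ?case
  proof (cases "\<forall>x\<in>X. \<rho> x = 0")
    case True
    have "f x = (\<Sum>i<m. f (a i) * \<phi> i x)" if "f \<in> ?W" "x \<in> X" for f x
    proof -
      obtain c g where g: "g \<in> function_space.span T" "f = (\<lambda>x. c * \<psi> x + g x)"
        using split[OF \<open>f \<in> ?W\<close>] by blast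
      have "\<psi> x = (\<Sum>i<m. \<psi> (a i) * \<phi> i x)"
        using True \<open>x \<in> X\<close> by (simp add: \<rho>_def)
      then show ?thesis
        by (simp add: g(2) rep[OF g(1) \<open>x \<in> X\<close>] sum_distrib_left sum.distrib algebra_simps)
    qed
    then show ?thesis
      using \<phi> TW a dual by (intro exI[of _ m] exI[of _ \<phi>] exI[of _ a]) blast
  next
    case False
    then obtain z where z: "z \<in> X" "\<rho> z \<noteq> 0" by blast
    define \<sigma> where "\<sigma> = (\<lambda>x. inverse (\<rho> z) * \<rho> x)"
    define \<phi>' where "\<phi>' = (\<lambda>i x. if i < m then \<phi> i x - \<phi> i z * \<sigma> x else \<sigma> x)"
    define a' where "a' = (\<lambda>i. if i < m then a i else z)"
    have \<sigma>W: "\<sigma> \<in> ?W" unfolding \<sigma>_def by (intro function_space.span_scale \<rho>W)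
    have \<sigma>z: "\<sigma> z = 1" "\<And>j. j < m \<Longrightarrow> \<sigma> (a j) = 0"
      using z by (auto simp: \<sigma>_def \<rho>0)
    have "\<phi>' i \<in> ?W" for i
    proof (cases "i < m")
      case True
      have "\<phi> i - (\<lambda>x. \<phi> i z * \<sigma> x) \<in> ?W"
        by (intro function_space.span_diff function_space.span_scale TW \<phi> True \<sigma>W)
      then show ?thesis using True by (simp add: \<phi>'_def fun_diff_def)
    qed (simp add: \<phi>'_def \<sigma>W)
    moreover have "a' i \<in> X" for i
      using a z by (auto simp: a'_def)
    moreover have "\<phi>' i (a' j) = (if i = j then 1 else 0)" if "i < Suc m" "j < Suc m" for i j
      using that by (auto simp: \<phi>'_def a'_def \<sigma>z dual)
    moreover have "f x = (\<Sum>i<Suc m. f (a' i) * \<phi>' i x)" if "f \<in> ?W" "x \<in> X" for f x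
    proof -
      obtain c g where g: "g \<in> function_space.span T" "f = (\<lambda>x. c * \<psi> x + g x)"
        using split[OF \<open>f \<in> ?W\<close>] by blast
      have sum: "(\<Sum>i<Suc m. h (a' i) * \<phi>' i x) =
        (\<Sum>i<m. h (a i) * \<phi> i x) + (h z - (\<Sum>i<m. h (a i) * \<phi> i z)) * \<sigma> x" for h
        by (simp add: \<phi>'_def a'_def algebra_simps sum_subtractf sum_distrib_left sum_distrib_right)
      have "\<psi> x = (\<Sum>i<Suc m. \<psi> (a' i) * \<phi>' i x)"
      proof -
        have "(\<psi> z - (\<Sum>i<m. \<psi> (a i) * \<phi> i z)) * \<sigma> x = \<rho> x"
          using z(2) by (simp add: \<sigma>_def flip: \<rho>_def[THEN fun_cong])
        then show ?thesis unfolding sum by (simp add: \<rho>_def)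
      qed
      moreover have "g x = (\<Sum>i<Suc m. g (a' i) * \<phi>' i x)"
        unfolding sum using rep[OF g(1) \<open>x \<in> X\<close>] rep[OF g(1) z(1)] by simp
      ultimately show ?thesis
        unfolding g(2) by (simp add: sum_distrib_left sum.distrib algebra_simps del: sum.lessThan_Suc)
    qed
    ultimately show ?thesis
      by (intro exI[of _ "Suc m"] exI[of _ \<phi>'] exI[of _ a']) blast
  qed
qed

section \<open>Semi-invariants separating the cosets of a closed subgroup\<close>

lemma matrix_entry_in_generated_algebra: "(\<lambda>x. x $ i $ j) \<in> generated_algebra matrix_entries"
  by (rule generated_algebra.gen) (auto simp: matrix_entries_def)

lemma generated_algebra_matrix_entries_translate:
  fixes p :: "complex ^ 'n ^ 'n \<Rightarrow> complex"
  assumes "p \<in> generated_algebra matrix_entries"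
  shows "(\<lambda>x. p (g ** x ** h)) \<in> generated_algebra matrix_entries"
proof (rule generated_algebra_comp[OF assms])
  fix f :: "complex ^ 'n ^ 'n \<Rightarrow> complex" assume "f \<in> matrix_entries"
  then obtain i j where f: "f = (\<lambda>x. x $ i $ j)" by (auto simp: matrix_entries_def)
  have "(\<lambda>x. \<Sum>l\<in>UNIV. (\<Sum>k\<in>UNIV. g $ i $ k * x $ k $ l) * h $ l $ j)
      \<in> generated_algebra matrix_entries"
    by (intro generated_algebra_sum generated_algebra.mult generated_algebra.const
        matrix_entry_in_generated_algebra)
  then show "(\<lambda>x. f (g ** x ** h)) \<in> generated_algebra matrix_entries"
    by (simp add: f matrix_matrix_mult_def)
qed

text \<open>
  Local finiteness of the translation action: the entries of \<open>g ** x\<close> in column \<open>j\<close> are linear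
  combinations of the entries of \<open>x\<close> in column \<open>j\<close>, and translation-stable spans are closed under
  sums and products.
\<close>

lemma left_translates_span_finite:
  fixes p :: "complex ^ 'n ^ 'n \<Rightarrow> complex"
  assumes "p \<in> generated_algebra matrix_entries"
  shows "\<exists>T. finite T \<and> T \<subseteq> generated_algebra matrix_entries \<and> p \<in> function_space.span T \<and>
    (\<forall>t\<in>T. \<forall>g. (\<lambda>x. t (g ** x)) \<in> function_space.span T)"
  using assms
proof (induction rule: generated_algebra.induct)
  case (gen f)
  then obtain i j where f: "f = (\<lambda>x. x $ i $ j)" by (auto simp: matrix_entries_def)
  let ?T = "range (\<lambda>k (x :: complex ^ 'n ^ 'n). x $ k $ j)"
  have "(\<lambda>x. (g ** x) $ k $ j) \<in> function_space.span ?T" for g :: "complex ^ 'n ^ 'n" and k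
  proof -
    have "(\<Sum>l\<in>UNIV. (\<lambda>x :: complex ^ 'n ^ 'n. g $ k $ l * x $ l $ j)) \<in> function_space.span ?T"
      by (intro function_space.span_sum function_space.span_scale function_space.span_base) simp
    moreover have "(\<Sum>l\<in>UNIV. (\<lambda>x :: complex ^ 'n ^ 'n. g $ k $ l * x $ l $ j)) = (\<lambda>x. (g ** x) $ k $ j)"
    proof -
      have "(\<Sum>l\<in>A. (\<lambda>x :: complex ^ 'n ^ 'n. g $ k $ l * x $ l $ j)) x = (\<Sum>l\<in>A. g $ k $ l * x $ l $ j)"
        for x A by (induction A rule: infinite_finite_induct) auto
      then show ?thesis by (simp add: fun_eq_iff matrix_matrix_mult_def)
    qed
    ultimately show ?thesis by simp
  qed
  moreover have "f \<in> function_space.span ?T"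
    unfolding f by (rule function_space.span_base) simp
  moreover have "?T \<subseteq> generated_algebra matrix_entries"
    using matrix_entry_in_generated_algebra by auto
  ultimately show ?case by (intro exI[of _ ?T]) auto
next
  case (const c)
  let ?T = "{\<lambda>_ :: complex ^ 'n ^ 'n. 1 :: complex}"
  have "(\<lambda>x. c * 1) \<in> function_space.span ?T"
    by (intro function_space.span_scale function_space.span_base) simp
  then show ?case
    by (intro exI[of _ ?T]) (auto intro: generated_algebra.const function_space.span_base)
next
  case (add f g)
  obtain S where S: "finite S" "S \<subseteq> generated_algebra matrix_entries" "f \<in> function_space.span S"
    "\<forall>t\<in>S. \<forall>g. (\<lambda>x. t (g ** x)) \<in> function_space.span S"
    using add.IH(1) by (elim exE conjE)
  obtain T where T: "finite T" "T \<subseteq> generated_algebra matrix_entries" "g \<in> function_space.span T"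
    "\<forall>t\<in>T. \<forall>g. (\<lambda>x. t (g ** x)) \<in> function_space.span T"
    using add.IH(2) by (elim exE conjE)
  have mono: "function_space.span S \<subseteq> function_space.span (S \<union> T)"
    "function_space.span T \<subseteq> function_space.span (S \<union> T)"
    by (simp_all add: function_space.span_mono)
  have "f + g \<in> function_space.span (S \<union> T)"
    using mono S(3) T(3) by (intro function_space.span_add) auto
  then have "(\<lambda>x. f x + g x) \<in> function_space.span (S \<union> T)" by (simp add: plus_fun_def)
  moreover have "\<forall>t\<in>S \<union> T. \<forall>g. (\<lambda>x. t (g ** x)) \<in> function_space.span (S \<union> T)"
    using S(4) T(4) mono by blast
  ultimately show ?case using S(1,2) T(1,2) by (intro exI[of _ "S \<union> T"]) simp
next
  case (mult f g)
  obtain S where S: "finite S" "S \<subseteq> generated_algebra matrix_entries" "f \<in> function_space.span S"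
    "\<forall>t\<in>S. \<forall>g. (\<lambda>x. t (g ** x)) \<in> function_space.span S"
    using mult.IH(1) by (elim exE conjE)
  obtain T where T: "finite T" "T \<subseteq> generated_algebra matrix_entries" "g \<in> function_space.span T"
    "\<forall>t\<in>T. \<forall>g. (\<lambda>x. t (g ** x)) \<in> function_space.span T"
    using mult.IH(2) by (elim exE conjE)
  let ?ST = "{\<lambda>x. s x * t x | s t. s \<in> S \<and> t \<in> T}"
  have "?ST = (\<lambda>(s, t) x. s x * t x) ` (S \<times> T)" by auto
  then have "finite ?ST" using S(1) T(1) by simp
  moreover have "?ST \<subseteq> generated_algebra matrix_entries"
    using S(2) T(2) by (auto intro!: generated_algebra.mult)
  moreover have "(\<lambda>x. f x * g x) \<in> function_space.span ?ST"
    using S(3) T(3) by (rule function_space_span_mult)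
  moreover have "\<forall>r\<in>?ST. \<forall>g. (\<lambda>x. r (g ** x)) \<in> function_space.span ?ST"
  proof (intro ballI allI)
    fix r g assume "r \<in> ?ST"
    then obtain s t where st: "s \<in> S" "t \<in> T" "r = (\<lambda>x. s x * t x)" by blast
    have "(\<lambda>x. s (g ** x) * t (g ** x)) \<in> function_space.span ?ST"
      using S(4) T(4) st by (intro function_space_span_mult) simp_all
    then show "(\<lambda>x. r (g ** x)) \<in> function_space.span ?ST" by (simp add: st(3))
  qed
  ultimately show ?case by (intro exI[of _ ?ST]) simp
qed

lemma span_left_translates:
  assumes "\<And>t g. t \<in> T \<Longrightarrow> (\<lambda>x. t (g ** x)) \<in> function_space.span T"
    and "f \<in> function_space.span T"
  shows "(\<lambda>x. f (g ** x)) \<in> function_space.span T"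
  using assms(2)
proof (induction rule: function_space.span_induct_alt)
  case base
  show ?case using function_space.span_zero by (simp add: zero_fun_def)
next
  case (step c t f)
  have "(\<lambda>x. c * t (g ** x)) + (\<lambda>x. f (g ** x)) \<in> function_space.span T"
    by (intro function_space.span_add[OF _ step(2)] function_space.span_scale assms(1) step(1))
  then show ?case by (simp add: plus_fun_def)
qed

lemma span_subset_generated_algebra:
  assumes "T \<subseteq> generated_algebra F"
  shows "function_space.span T \<subseteq> generated_algebra F"
proof
  fix f assume "f \<in> function_space.span T"
  then show "f \<in> generated_algebra F"
  proof (induction rule: function_space.span_induct_alt)
    case base
    show ?case using generated_algebra.const[of 0 F] by (simp add: zero_fun_def)
  next
    case (step c t f)
    have "(\<lambda>x. c * t x + f x) \<in> generated_algebra F"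
      using step assms by (intro generated_algebra.add generated_algebra.mult generated_algebra.const) auto
    then show ?case by (simp add: plus_fun_def)
  qed
qed

lemma det_identity_with_row:
  fixes c :: "nat \<Rightarrow> 'a :: comm_ring_1"
  assumes "k < m"
  shows "Determinant.det (Matrix.mat m m (\<lambda>(j, i). if j = k then c i else if j = i then 1 else 0)) = c k"
    (is "Determinant.det ?M = _")
proof -
  have "Determinant.det ?M = (\<Sum>j<m. ?M $$ (j, k) * cofactor ?M j k)"
    using assms by (intro laplace_expansion_column) auto
  also have "\<dots> = (\<Sum>j<m. if j = k then c k * cofactor ?M k k else 0)"
    using assms by (intro sum.cong) auto
  also have "\<dots> = c k * cofactor ?M k k"
    using assms by simp
  also have "mat_delete ?M k k = 1\<^sub>m (m - 1)"
    using assms by (intro eq_matI) (auto simp: mat_delete_def)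
  then have "cofactor ?M k k = 1"
    by (simp add: cofactor_def)
  finally show ?thesis by simp
qed

lemma det_in_generated_algebra:
  assumes "\<And>i j. i < m \<Longrightarrow> j < m \<Longrightarrow> f i j \<in> generated_algebra F"
  shows "(\<lambda>x. Determinant.det (Matrix.mat m m (\<lambda>(i, j). f i j x))) \<in> generated_algebra F"
proof -
  have "(\<lambda>x. \<Sum>p | p permutes {0..<m}. signof p * (\<Prod>i = 0..<m. f i (p i) x)) \<in> generated_algebra F"
    using assms
    by (intro generated_algebra_sum generated_algebra.mult generated_algebra.const generated_algebra_prod)
      (metis atLeastLessThan_iff mem_Collect_eq permutes_in_image zero_le)
  moreover have "Determinant.det (Matrix.mat m m (\<lambda>(i, j). f i j x)) =
      (\<Sum>p | p permutes {0..<m}. signof p * (\<Prod>i = 0..<m. f i (p i) x))" for x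
  proof -
    have "(\<Prod>i = 0..<m. Matrix.mat m m (\<lambda>(i, j). f i j x) $$ (i, p i)) = (\<Prod>i = 0..<m. f i (p i) x)"
      if "p permutes {0..<m}" for p
    proof (rule prod.cong[OF refl])
      fix i assume i: "i \<in> {0..<m}"
      then have "p i \<in> {0..<m}" using permutes_in_image[OF that] by simp
      then show "Matrix.mat m m (\<lambda>(i, j). f i j x) $$ (i, p i) = f i (p i) x" using i by simp
    qed
    then show ?thesis unfolding det_def by simp
  qed
  ultimately show ?thesis by simp
qed

text \<open>
  An elementary form of Chevalley's theorem realising \<open>B\<close> as the stabiliser of a line. Let \<open>W\<close> be a
  finite-dimensional space of polynomials, stable under left translation and containing \<open>p\<close>. The
  evaluations at the points of \<open>g B\<close> span a subspace of the dual of \<open>W\<close> which depends only on the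
  coset, and its Pluecker coordinates are the determinants \<open>det (\<psi> j (g ** a i))\<close>, where the evaluations at
  the \<open>a i \<in> B\<close> form a basis of the subspace attached to \<open>B\<close> itself. Replacing \<open>g\<close> by \<open>g ** b\<close> is a change of basis
  given by a matrix that does not depend on \<open>g\<close>, so all these coordinates are multiplied by the same
  factor \<open>\<eta> b\<close>. A translate \<open>q\<close> of \<open>p\<close> vanishes on \<open>g B\<close> but not at \<open>h\<close>: a determinant with \<open>q\<close> among its
  rows therefore vanishes at \<open>g\<close>, and the other rows can be chosen so that it does not vanish at \<open>h\<close>.
\<close>

lemma semi_invariants_separating_cosets:
  fixes B :: "(complex ^ 'n ^ 'n) set"
  assumes one: "mat 1 \<in> B" and mult: "\<And>b c. b \<in> B \<Longrightarrow> c \<in> B \<Longrightarrow> b ** c \<in> B"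
    and p: "p \<in> generated_algebra matrix_entries" "\<And>b. b \<in> B \<Longrightarrow> p b = 0"
    and inv: "g' ** g = mat 1" "h' ** h = mat 1" and ne: "p (g' ** h) \<noteq> 0"
  shows "\<exists>F F' \<eta>. F \<in> generated_algebra matrix_entries \<and> F' \<in> generated_algebra matrix_entries \<and>
    (\<forall>x. \<forall>b\<in>B. F (x ** b) = F x * \<eta> b \<and> F' (x ** b) = F' x * \<eta> b) \<and>
    F g \<noteq> 0 \<and> F' g = 0 \<and> F' h \<noteq> 0"
proof -
  obtain T where T: "finite T" "T \<subseteq> generated_algebra matrix_entries" "p \<in> function_space.span T"
    "\<forall>t\<in>T. \<forall>g. (\<lambda>x. t (g ** x)) \<in> function_space.span T"
    using left_translates_span_finite[OF p(1)] by (elim exE conjE)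
  let ?W = "function_space.span T"
  have transl: "(\<lambda>x. f (g ** x)) \<in> ?W" if "f \<in> ?W" for f g
    by (rule span_left_translates[OF _ that]) (rule T(4)[rule_format])
  obtain m :: nat and \<phi> a where *: "(\<forall>i<m. \<phi> i \<in> ?W \<and> a i \<in> B) \<and>
    (\<forall>i<m. \<forall>j<m. \<phi> i (a j) = (if i = j then 1 else 0)) \<and>
    (\<forall>f\<in>?W. \<forall>x\<in>B. f x = (\<Sum>i<m. f (a i) * \<phi> i x))"
    using dual_bases_on_set[OF T(1), of B] by (elim exE)
  have \<phi>: "\<And>i. i < m \<Longrightarrow> \<phi> i \<in> ?W" and a: "\<And>i. i < m \<Longrightarrow> a i \<in> B"
    and dual: "\<And>i j. i < m \<Longrightarrow> j < m \<Longrightarrow> \<phi> i (a j) = (if i = j then 1 else 0)"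
    and rep: "\<And>f x. f \<in> ?W \<Longrightarrow> x \<in> B \<Longrightarrow> f x = (\<Sum>i<m. f (a i) * \<phi> i x)"
    using * by simp_all
  \<comment> \<open>The Pluecker coordinates, and the character by which \<open>B\<close> acts on them.\<close>
  define D where "D = (\<lambda>(\<psi> :: nat \<Rightarrow> complex ^ 'n ^ 'n \<Rightarrow> complex) x. Determinant.det (Matrix.mat m m (\<lambda>(j, i). \<psi> j (x ** a i))))"
  define \<eta> where "\<eta> = (\<lambda>b. Determinant.det (Matrix.mat m m (\<lambda>(k, i). \<phi> k (b ** a i))))"
  have D_algebra: "D \<psi> \<in> generated_algebra matrix_entries"
    if "\<And>j. j < m \<Longrightarrow> \<psi> j \<in> ?W" for \<psi>
    unfolding D_def
  proof (rule det_in_generated_algebra)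
    fix j i assume "j < m"
    then have "\<psi> j \<in> generated_algebra matrix_entries"
      using that span_subset_generated_algebra[OF T(2)] by blast
    from generated_algebra_matrix_entries_translate[OF this, of "mat 1" "a i"]
    show "(\<lambda>x. \<psi> j (x ** a i)) \<in> generated_algebra matrix_entries" by simp
  qed
  have D_mult: "D \<psi> (x ** b) = D \<psi> x * \<eta> b" if \<psi>: "\<And>j. j < m \<Longrightarrow> \<psi> j \<in> ?W" and "b \<in> B"
    for \<psi> x b
  proof -
    have "\<psi> j (x ** b ** a i) = (\<Sum>k<m. \<psi> j (x ** a k) * \<phi> k (b ** a i))" if "j < m" "i < m" for i j
      using rep[OF transl[OF \<psi>[OF \<open>j < m\<close>], of x] mult[OF \<open>b \<in> B\<close> a[OF \<open>i < m\<close>]]]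
      by (simp add: matrix_mul_assoc)
    then have "Matrix.mat m m (\<lambda>(j, i). \<psi> j (x ** b ** a i)) =
        Matrix.mat m m (\<lambda>(j, i). \<psi> j (x ** a i)) * Matrix.mat m m (\<lambda>(k, i). \<phi> k (b ** a i))"
      by (intro eq_matI) (auto simp: scalar_prod_def atLeast0LessThan)
    then show ?thesis
      unfolding D_def \<eta>_def by (simp add: det_mult[where n = m])
  qed
  define \<psi> where "\<psi> = (\<lambda>j y. \<phi> j (g' ** y))"
  have \<psi>W: "\<psi> j \<in> ?W" if "j < m" for j
    unfolding \<psi>_def by (rule transl[OF \<phi>[OF that]])
  define q where "q = (\<lambda>y. p (g' ** y))"
  have qW: "q \<in> ?W" unfolding q_def by (rule transl[OF T(3)])
  \<comment> \<open>The function \<open>q\<close> is nonzero at a point of \<open>h B\<close>, hence at one of the points \<open>h ** a k\<close> of the basis.\<close>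
  have "q (h ** mat 1) = (\<Sum>i<m. q (h ** a i) * \<phi> i (mat 1))"
    using rep[OF transl[OF qW, of h] one] .
  moreover have "q (h ** mat 1) \<noteq> 0" using ne by (simp add: q_def)
  ultimately have "(\<Sum>i<m. q (h ** a i) * \<phi> i (mat 1)) \<noteq> 0" by simp
  then obtain k where "k \<in> {..<m}" "q (h ** a k) * \<phi> k (mat 1) \<noteq> 0"
    by (rule sum.not_neutral_contains_not_neutral)
  then obtain k where k: "k < m" "q (h ** a k) \<noteq> 0" by auto
  \<comment> \<open>Dual to the points \<open>h ** a i\<close>, except that \<open>q\<close> takes the place of the function belonging to \<open>h ** a k\<close>.\<close>
  define \<psi>' where "\<psi>' = (\<lambda>j y. if j = k then q y else \<phi> j (h' ** y))"
  have \<psi>'W: "\<psi>' j \<in> ?W" if "j < m" for j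
    using qW transl[OF \<phi>[OF that]] by (cases "j = k") (simp_all add: \<psi>'_def)
  have "D \<psi> g = Determinant.det (1\<^sub>m m)"
    unfolding D_def by (rule arg_cong[of _ _ Determinant.det], rule eq_matI)
      (simp_all add: \<psi>_def inv matrix_mul_assoc dual)
  then have "D \<psi> g \<noteq> 0" by simp
  moreover have "D \<psi>' h \<noteq> 0"
  proof -
    have "Matrix.mat m m (\<lambda>(j, i). \<psi>' j (h ** a i)) =
        Matrix.mat m m (\<lambda>(j, i). if j = k then q (h ** a i) else if j = i then 1 else 0)"
      by (rule eq_matI) (simp_all add: \<psi>'_def inv matrix_mul_assoc dual)
    then show ?thesis
      unfolding D_def using det_identity_with_row[OF k(1), of "\<lambda>i. q (h ** a i)"] k(2) by simp
  qed
  moreover have "D \<psi>' g = 0"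
  proof -
    let ?M = "Matrix.mat m m (\<lambda>(j, i). \<psi>' j (g ** a i))"
    have "Determinant.det ?M = (\<Sum>i<m. ?M $$ (k, i) * cofactor ?M k i)"
      using k(1) by (intro laplace_expansion_row) auto
    also have "\<dots> = 0"
      using k(1) a p(2) by (intro sum.neutral) (auto simp: \<psi>'_def q_def inv matrix_mul_assoc)
    finally show ?thesis unfolding D_def .
  qed
  ultimately show ?thesis
    using D_algebra D_mult \<psi>W \<psi>'W by (intro exI[of _ "D \<psi>"] exI[of _ "D \<psi>'"] exI[of _ \<eta>]) simp
qed

section \<open>Separatedness of the flag variety\<close>

lemma group_GL: "group (GL :: ('n::finite) mat monoid)"
proof (rule groupI)
  fix x :: "'n mat" assume "x \<in> carrier GL"
  then show "\<exists>y\<in>carrier GL. y \<otimes>\<^bsub>GL\<^esub> x = \<one>\<^bsub>GL\<^esub>"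
    by (auto simp: GL_def invertible_def)
next
  show "\<one>\<^bsub>GL\<^esub> \<in> carrier GL"
    by (auto simp: GL_def invertible_def intro: exI[of _ "mat 1"])
qed (simp_all add: GL_def invertible_mult matrix_mul_assoc)

lemma subgroup_GL_inverse:
  fixes B :: "('n::finite) mat set"
  assumes "subgroup B GL" and "b \<in> B"
  obtains c where "c \<in> B" "b ** c = mat 1" "c ** b = mat 1"
proof
  interpret GL: group "GL :: 'n mat monoid" by (rule group_GL)
  have b: "b \<in> carrier GL" using assms subgroup.subset by blast
  show "inv\<^bsub>GL\<^esub> b \<in> B" using assms by (rule subgroup.m_inv_closed)
  show "b ** inv\<^bsub>GL\<^esub> b = mat 1" "inv\<^bsub>GL\<^esub> b ** b = mat 1"
    using GL.r_inv[OF b] GL.l_inv[OF b] by (simp_all add: GL_def)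
qed

lemma subgroup_GL_closed:
  assumes "subgroup B GL"
  shows "mat 1 \<in> B" and "b \<in> B \<Longrightarrow> c \<in> B \<Longrightarrow> b ** c \<in> B" and "b \<in> B \<Longrightarrow> invertible b"
  using subgroup.one_closed[OF assms] subgroup.m_closed[OF assms] subgroup.subset[OF assms]
  by (auto simp: GL_def)

lemma l_coset_GL: "g <#\<^bsub>GL\<^esub> B = (\<lambda>b. g ** b) ` B"
  by (auto simp: l_coset_def GL_def)

lemma l_coset_GL_eqD:
  assumes "subgroup B GL" and "g <#\<^bsub>GL\<^esub> B = h <#\<^bsub>GL\<^esub> B"
  obtains b where "b \<in> B" "h = g ** b"
proof -
  have "h ** mat 1 \<in> h <#\<^bsub>GL\<^esub> B"
    unfolding l_coset_GL using subgroup_GL_closed(1)[OF assms(1)] by (rule imageI)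
  then have "h \<in> g <#\<^bsub>GL\<^esub> B" using assms(2) by simp
  then show thesis using that unfolding l_coset_GL by blast
qed

lemma l_coset_GL_mult:
  assumes "subgroup B GL" and "b \<in> B"
  shows "(g ** b) <#\<^bsub>GL\<^esub> B = g <#\<^bsub>GL\<^esub> B"
proof (rule equalityI)
  show "(g ** b) <#\<^bsub>GL\<^esub> B \<subseteq> g <#\<^bsub>GL\<^esub> B"
    unfolding l_coset_GL using subgroup_GL_closed(2)[OF assms(1) assms(2)]
    by (auto simp flip: matrix_mul_assoc)
  obtain c where c: "c \<in> B" "b ** c = mat 1" using subgroup_GL_inverse[OF assms] .
  show "g <#\<^bsub>GL\<^esub> B \<subseteq> (g ** b) <#\<^bsub>GL\<^esub> B"
  proof
    fix x assume "x \<in> g <#\<^bsub>GL\<^esub> B"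
    then obtain d where d: "d \<in> B" "x = g ** d" unfolding l_coset_GL by blast
    have "g ** d = (g ** b) ** (c ** d)"
      using c(2) by (metis matrix_mul_assoc matrix_mul_rid)
    then show "x \<in> (g ** b) <#\<^bsub>GL\<^esub> B"
      unfolding l_coset_GL d(2) using subgroup_GL_closed(2)[OF assms(1) c(1) d(1)] by (rule image_eqI)
  qed
qed

lemma points_var:
  assumes "subgroup G GL"
  shows "points (var G) = G"
  using subgroup_GL_closed(3)[OF assms]
  by (auto simp: induced_def GL_variety_def points_affine_locus)

lemma openin_GL_variety_nonvanishing:
  assumes "p \<in> generated_algebra matrix_entries"
  shows "openin (zar GL_variety) {g. invertible g \<and> p g \<noteq> 0}"
  unfolding GL_variety_def openin_affine_locus_iff using assms by auto

lemma openin_quotient_variety: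
  assumes "V \<subseteq> \<pi> ` points X" and "openin (zar X) {x \<in> points X. \<pi> x \<in> V}"
  shows "openin (zar (quotient_variety X \<pi>)) V"
  unfolding quotient_variety_def fspace.select_convs
  by (rule topology_generated_by_Basis) (use assms in simp)

lemma points_quotient_variety: "points (quotient_variety X \<pi>) = \<pi> ` points X"
proof (rule equalityI)
  show "points (quotient_variety X \<pi>) \<subseteq> \<pi> ` points X"
    unfolding quotient_variety_def by (auto simp: topology_generated_by_topspace)
  have "{x \<in> points X. \<pi> x \<in> \<pi> ` points X} = points X" by auto
  then have "openin (zar (quotient_variety X \<pi>)) (\<pi> ` points X)"
    by (intro openin_quotient_variety) simp_all
  then show "\<pi> ` points X \<subseteq> points (quotient_variety X \<pi>)" by (rule openin_subset)
qed

text \<open>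
  The quotient of two semi-invariants with the same character is constant on cosets, and it is a regular
  function on the open set of the cosets on which the denominator does not vanish.
\<close>

lemma flag_variety_fraction:
  fixes F F' :: "('n::finite) mat \<Rightarrow> complex"
  assumes G: "subgroup G GL" and B: "subgroup B GL"
    and F: "F \<in> generated_algebra matrix_entries" "F' \<in> generated_algebra matrix_entries"
    and semi: "\<And>x b. b \<in> B \<Longrightarrow> F (x ** b) = F x * \<eta> b" "\<And>x b. b \<in> B \<Longrightarrow> F' (x ** b) = F' x * \<eta> b"
  obtains U u where "openin (zar (flag_variety G B)) U" "u \<in> reg (flag_variety G B) U"
    "\<And>g. g \<in> G \<Longrightarrow> g <#\<^bsub>GL\<^esub> B \<in> U \<longleftrightarrow> F g \<noteq> 0"
    "\<And>g. g \<in> G \<Longrightarrow> F g \<noteq> 0 \<Longrightarrow> u (g <#\<^bsub>GL\<^esub> B) = F' g / F g"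
proof -
  let ?\<pi> = "\<lambda>g. g <#\<^bsub>GL\<^esub> B"
  have nz: "F h \<noteq> 0 \<and> F' h / F h = F' g / F g" if eq: "?\<pi> g = ?\<pi> h" and "F g \<noteq> 0" for g h
  proof -
    obtain b where b: "b \<in> B" "h = g ** b" using l_coset_GL_eqD[OF B eq] .
    obtain c where c: "c \<in> B" "b ** c = mat 1" using subgroup_GL_inverse[OF B b(1)] .
    \<comment> \<open>The factor \<open>\<eta> b\<close> is a unit, because the inverse of \<open>b\<close> lies in \<open>B\<close>.\<close>
    have "F g = F (g ** b ** c)" using c(2) by (simp flip: matrix_mul_assoc)
    then have "F g = F g * \<eta> b * \<eta> c" using semi(1) b(1) c(1) by simp
    then have "\<eta> b \<noteq> 0" using \<open>F g \<noteq> 0\<close> by auto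
    then show ?thesis using semi[OF b(1)] \<open>F g \<noteq> 0\<close> by (simp add: b(2))
  qed
  define U where "U = ?\<pi> ` {g \<in> G. F g \<noteq> 0}"
  define u where "u = (\<lambda>c. F' (SOME g. ?\<pi> g = c) / F (SOME g. ?\<pi> g = c))"
  have U: "?\<pi> g \<in> U \<longleftrightarrow> F g \<noteq> 0" if "g \<in> G" for g
  proof
    assume "?\<pi> g \<in> U"
    then obtain h where "F h \<noteq> 0" "?\<pi> g = ?\<pi> h" unfolding U_def by blast
    then show "F g \<noteq> 0" using nz[of h g] by simp
  qed (use that in \<open>auto simp: U_def\<close>)
  have u: "u (?\<pi> g) = F' g / F g" if "F g \<noteq> 0" for g
  proof -
    have "?\<pi> (SOME h. ?\<pi> h = ?\<pi> g) = ?\<pi> g" by (rule someI[of "\<lambda>h. ?\<pi> h = ?\<pi> g"]) simp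
    from nz[OF this[symmetric] that] show ?thesis unfolding u_def by simp
  qed
  have preimage: "{g \<in> points (var G). ?\<pi> g \<in> U} = {g \<in> G. F g \<noteq> 0}"
    using U by (auto simp: points_var[OF G])
  have "{g \<in> G. F g \<noteq> 0} = {g. invertible g \<and> F g \<noteq> 0} \<inter> G"
    using subgroup_GL_closed(3)[OF G] by auto
  then have "openin (zar (var G)) {g \<in> G. F g \<noteq> 0}"
    using openin_GL_variety_nonvanishing[OF F(1)]
    by (simp add: induced_def openin_subtopology_Int)
  then have "openin (zar (flag_variety G B)) U"
    unfolding flag_variety_def
    by (intro openin_quotient_variety) (simp_all only: preimage, auto simp: U_def points_var[OF G])
  moreover have "u \<in> reg (flag_variety G B) U"
  proof -
    have "(\<lambda>g. F' g / F g) \<in> reg GL_variety {g. invertible g \<and> F g \<noteq> 0}"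
      using F unfolding GL_variety_def affine_locus_def by auto
    then have "u \<circ> ?\<pi> \<in> reg (var G) {g \<in> G. F g \<noteq> 0}"
      using openin_GL_variety_nonvanishing[OF F(1)] subgroup_GL_closed(3)[OF G] u
      unfolding induced_def
      by (auto intro!: exI[of _ "{g. invertible g \<and> F g \<noteq> 0}"] exI[of _ "\<lambda>g. F' g / F g"])
    then show ?thesis
      unfolding flag_variety_def quotient_variety_def by (simp add: preimage)
  qed
  ultimately show thesis using that U u by blast
qed

text \<open>
  The topology of a product variety is finer than the product topology: it contains the non-vanishing
  loci of sums of products of functions on the factors. The condition below says that the function
  \<open>u z * v w - 1\<close> of \<open>(z, w)\<close> cuts out a neighbourhood of \<open>(x, y)\<close> that misses the diagonal, so it
  implies that the diagonal is closed. Disjoint neighbourhoods of \<open>x\<close> and \<open>y\<close> would be too much to ask, as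
  nonempty open subsets of an irreducible variety always meet.
\<close>

definition function_separated :: "'a fspace \<Rightarrow> 'a fspace \<Rightarrow> bool" where
  "function_separated X Y \<longleftrightarrow> (\<forall>x\<in>points X. \<forall>y\<in>points Y. x \<noteq> y \<longrightarrow>
     (\<exists>U V u v. openin (zar X) U \<and> openin (zar Y) V \<and> x \<in> U \<and> y \<in> V \<and>
        u \<in> reg X U \<and> v \<in> reg Y V \<and> u x * v y \<noteq> 1 \<and> (\<forall>z\<in>U \<inter> V. u z * v z = 1)))"

lemma closed_in_GL_variety_vanishing:
  assumes "closedin (zar GL_variety) B" and "invertible z" and "z \<notin> B"
  shows "\<exists>p\<in>generated_algebra matrix_entries. p z \<noteq> 0 \<and> (\<forall>b\<in>B. p b = 0)"
proof -
  have pts: "points GL_variety = {g. invertible g}"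
    by (simp add: GL_variety_def points_affine_locus)
  have "openin (zar GL_variety) ({g. invertible g} - B)" and sub: "B \<subseteq> {g. invertible g}"
    using assms(1) by (auto simp: closedin_def pts)
  then have "\<forall>x\<in>{g. invertible g} - B. \<exists>p\<in>generated_algebra matrix_entries.
      p x \<noteq> 0 \<and> {y \<in> {g. invertible g}. p y \<noteq> 0} \<subseteq> {g. invertible g} - B"
    unfolding GL_variety_def openin_affine_locus_iff by (elim conjE)
  from bspec[OF this, of z] assms(2,3) obtain p where
    "p \<in> generated_algebra matrix_entries" "p z \<noteq> 0"
    "{y \<in> {g. invertible g}. p y \<noteq> 0} \<subseteq> {g. invertible g} - B" by auto
  then show ?thesis using sub by (intro bexI[of _ p]) auto
qed

text \<open>
  For \<open>g B \<noteq> h B\<close> there are semi-invariants \<open>F\<close>, \<open>F'\<close> with a common character such that \<open>F g \<noteq> 0\<close>,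
  \<open>F' g = 0\<close> and \<open>F' h \<noteq> 0\<close>. The functions \<open>u = F' / F\<close> near \<open>g B\<close> and \<open>v = F / F'\<close> near \<open>h B\<close> are inverse to
  each other wherever both are defined, while \<open>u\<close> vanishes at \<open>g B\<close>.
\<close>

lemma flag_variety_separated:
  fixes G B :: "('n::finite) mat set"
  assumes G: "subgroup G GL" and B: "algebraic_group B"
  shows "function_separated (flag_variety G B) (flag_variety G B)"
  unfolding function_separated_def
proof (intro ballI impI)
  let ?\<pi> = "\<lambda>g. g <#\<^bsub>GL\<^esub> B"
  let ?X = "flag_variety G B"
  have Bs: "subgroup B GL" and Bc: "closedin (zar GL_variety) B"
    using B by (auto simp: algebraic_group_def)
  fix x y assume "x \<in> points ?X" "y \<in> points ?X" "x \<noteq> y"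
  then obtain g h where g: "g \<in> G" "x = ?\<pi> g" and h: "h \<in> G" "y = ?\<pi> h"
    by (auto simp: flag_variety_def points_quotient_variety points_var[OF G])
  obtain g' where g': "g' \<in> G" "g ** g' = mat 1" "g' ** g = mat 1"
    using subgroup_GL_inverse[OF G g(1)] .
  obtain h' where h': "h' ** h = mat 1" using subgroup_GL_inverse[OF G h(1)] .
  have "g' ** h \<notin> B"
  proof
    assume *: "g' ** h \<in> B"
    have "g ** (g' ** h) = h" using g'(2) by (simp add: matrix_mul_assoc)
    then have "?\<pi> h = ?\<pi> g" using l_coset_GL_mult[OF Bs *, of g] by simp
    then show False using \<open>x \<noteq> y\<close> g(2) h(2) by simp
  qed
  moreover have "invertible (g' ** h)"
    using subgroup_GL_closed(2,3)[OF G] g'(1) h(1) by simp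
  ultimately obtain p where p: "p \<in> generated_algebra matrix_entries" "p (g' ** h) \<noteq> 0"
    "\<forall>b\<in>B. p b = 0"
    using closed_in_GL_variety_vanishing[OF Bc] by meson
  have "\<exists>F F' \<eta>. F \<in> generated_algebra matrix_entries \<and> F' \<in> generated_algebra matrix_entries \<and>
    (\<forall>x. \<forall>b\<in>B. F (x ** b) = F x * \<eta> b \<and> F' (x ** b) = F' x * \<eta> b) \<and>
    F g \<noteq> 0 \<and> F' g = 0 \<and> F' h \<noteq> 0"
    by (rule semi_invariants_separating_cosets[OF _ _ p(1) _ g'(3) h' p(2)])
      (use subgroup_GL_closed[OF Bs] p(3) in auto)
  then obtain F F' \<eta> where F: "F \<in> generated_algebra matrix_entries" "F' \<in> generated_algebra matrix_entries"
    and semi: "\<forall>x. \<forall>b\<in>B. F (x ** b) = F x * \<eta> b \<and> F' (x ** b) = F' x * \<eta> b"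
    and vals: "F g \<noteq> 0" "F' g = 0" "F' h \<noteq> 0"
    by (elim exE conjE)
  have semi': "F (x ** b) = F x * \<eta> b" "F' (x ** b) = F' x * \<eta> b" if "b \<in> B" for x b
    using semi that by simp_all
  obtain U u where U: "openin (zar ?X) U" "u \<in> reg ?X U"
    "\<And>g. g \<in> G \<Longrightarrow> ?\<pi> g \<in> U \<longleftrightarrow> F g \<noteq> 0"
    "\<And>g. g \<in> G \<Longrightarrow> F g \<noteq> 0 \<Longrightarrow> u (?\<pi> g) = F' g / F g"
    using flag_variety_fraction[OF G Bs F, of \<eta>] semi' by auto
  obtain V v where V: "openin (zar ?X) V" "v \<in> reg ?X V"
    "\<And>g. g \<in> G \<Longrightarrow> ?\<pi> g \<in> V \<longleftrightarrow> F' g \<noteq> 0"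
    "\<And>g. g \<in> G \<Longrightarrow> F' g \<noteq> 0 \<Longrightarrow> v (?\<pi> g) = F g / F' g"
    using flag_variety_fraction[OF G Bs F(2) F(1), of \<eta>] semi' by auto
  have "u z * v z = 1" if z: "z \<in> U \<inter> V" for z
  proof -
    have "z \<in> points ?X" using z U(1) openin_subset by blast
    then obtain k where k: "k \<in> G" "z = ?\<pi> k"
      by (auto simp: flag_variety_def points_quotient_variety points_var[OF G])
    then have "F k \<noteq> 0" "F' k \<noteq> 0" using z U(3) V(3) by auto
    then show ?thesis using U(4) V(4) k by simp
  qed
  moreover have "x \<in> U" "y \<in> V" using U(3) V(3) g h vals by auto
  moreover have "u x * v y \<noteq> 1" using U(4) g vals by simp
  ultimately show "\<exists>U V u v. openin (zar ?X) U \<and> openin (zar ?X) V \<and> x \<in> U \<and> y \<in> V \<and>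
        u \<in> reg ?X U \<and> v \<in> reg ?X V \<and> u x * v y \<noteq> 1 \<and> (\<forall>z\<in>U \<inter> V. u z * v z = 1)"
    using U(1,2) V(1,2) by (intro exI[of _ U] exI[of _ V] exI[of _ u] exI[of _ v]) simp
qed

section \<open>Closed diagonals in product varieties\<close>

lemma function_separatedD:
  assumes "function_separated X Y" and "x \<in> points X" and "y \<in> points Y" and "x \<noteq> y"
  shows "\<exists>U V u v. openin (zar X) U \<and> openin (zar Y) V \<and> x \<in> U \<and> y \<in> V \<and>
    u \<in> reg X U \<and> v \<in> reg Y V \<and> u x * v y \<noteq> 1 \<and> (\<forall>z\<in>U \<inter> V. u z * v z = 1)"
  using assms by (simp add: function_separated_def)

lemma reg_inducedI:
  assumes "\<And>x. x \<in> U \<Longrightarrow> \<exists>V g. openin (zar X) V \<and> x \<in> V \<and> g \<in> reg X V \<and> (\<forall>y\<in>U \<inter> V. f y = g y)"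
  shows "f \<in> reg (induced X Z) U"
  unfolding induced_def fspace.select_convs using assms by (intro CollectI ballI)

lemma reg_inducedD:
  assumes "f \<in> reg (induced X Z) U" and "x \<in> U"
  shows "\<exists>V g. openin (zar X) V \<and> x \<in> V \<and> g \<in> reg X V \<and> (\<forall>y\<in>U \<inter> V. f y = g y)"
  using bspec[OF CollectD[OF assms(1)[unfolded induced_def fspace.select_convs]] assms(2)] .

lemma function_separated_induced:
  assumes "function_separated X Y"
  shows "function_separated X (induced Y Z)"
  unfolding function_separated_def
proof (intro ballI impI)
  fix x y assume "x \<in> points X" "y \<in> points (induced Y Z)" "x \<noteq> y"
  then have y: "y \<in> points Y" "y \<in> Z" by (auto simp: induced_def)
  obtain U V u v where UV: "openin (zar X) U" "openin (zar Y) V" "x \<in> U" "y \<in> V"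
    "u \<in> reg X U" "v \<in> reg Y V" "u x * v y \<noteq> 1" "\<forall>z\<in>U \<inter> V. u z * v z = 1"
    using function_separatedD[OF assms \<open>x \<in> points X\<close> y(1) \<open>x \<noteq> y\<close>] by (elim exE conjE)
  have "openin (zar (induced Y Z)) (V \<inter> Z)"
    using UV(2) by (simp add: induced_def openin_subtopology_Int)
  moreover have "v \<in> reg (induced Y Z) (V \<inter> Z)"
    by (rule reg_inducedI) (use UV(2,6) in \<open>intro exI[of _ V] exI[of _ v]; auto\<close>)
  ultimately show "\<exists>U V u v. openin (zar X) U \<and> openin (zar (induced Y Z)) V \<and> x \<in> U \<and> y \<in> V \<and>
        u \<in> reg X U \<and> v \<in> reg (induced Y Z) V \<and> u x * v y \<noteq> 1 \<and> (\<forall>z\<in>U \<inter> V. u z * v z = 1)"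
    using UV y(2)
    by (intro exI[of _ U] exI[of _ "V \<inter> Z"] exI[of _ u] exI[of _ v]) simp
qed

lemma points_product_variety: "points (product_variety I X) = Pi\<^sub>E I (\<lambda>i. points (X i))"
proof (rule equalityI)
  show "points (product_variety I X) \<subseteq> Pi\<^sub>E I (\<lambda>i. points (X i))"
  proof
    fix x assume "x \<in> points (product_variety I X)"
    then obtain U where "\<forall>i\<in>I. openin (zar (X i)) (U i)" "x \<in> Pi\<^sub>E I U"
      unfolding product_variety_def by (auto simp: topology_generated_by_topspace)
    moreover from this(1) have "Pi\<^sub>E I U \<subseteq> Pi\<^sub>E I (\<lambda>i. points (X i))"
      by (intro PiE_mono openin_subset) simp
    ultimately show "x \<in> Pi\<^sub>E I (\<lambda>i. points (X i))" by blast
  qed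
  have "(\<lambda>_. 1) \<in> product_functions X I (\<lambda>i. points (X i))"
    unfolding product_functions_def by (rule generated_algebra.const)
  then have "openin (zar (product_variety I X)) {x \<in> Pi\<^sub>E I (\<lambda>i. points (X i)). (1::complex) \<noteq> 0}"
    unfolding product_variety_def fspace.select_convs
    by (intro topology_generated_by_Basis CollectI exI[of _ "\<lambda>i. points (X i)"] exI[of _ "\<lambda>_. 1"]) auto
  from openin_subset[OF this] show "Pi\<^sub>E I (\<lambda>i. points (X i)) \<subseteq> points (product_variety I X)"
    by simp
qed

lemma closedin_product_variety_diagonal:
  assumes ij: "i \<in> I" "j \<in> I" "i \<noteq> j" and sep: "function_separated (X i) (X j)"
  shows "closedin (zar (product_variety I X)) {x \<in> points (product_variety I X). x i = x j}"
proof -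
  let ?P = "product_variety I X"
  have "\<exists>W. openin (zar ?P) W \<and> x \<in> W \<and> W \<subseteq> {x \<in> points ?P. x i \<noteq> x j}"
    if "x \<in> {x \<in> points ?P. x i \<noteq> x j}" for x
  proof -
    from that have x: "x \<in> Pi\<^sub>E I (\<lambda>i. points (X i))" "x i \<noteq> x j"
      by (simp_all add: points_product_variety)
    then have xij: "x i \<in> points (X i)" "x j \<in> points (X j)" using ij by auto
    obtain U V u v where UV: "openin (zar (X i)) U" "openin (zar (X j)) V" "x i \<in> U" "x j \<in> V"
      "u \<in> reg (X i) U" "v \<in> reg (X j) V" "u (x i) * v (x j) \<noteq> 1" "\<forall>z\<in>U \<inter> V. u z * v z = 1"
      using function_separatedD[OF sep xij x(2)] by (elim exE conjE)
    define U' where "U' = (\<lambda>k. points (X k))(i := U, j := V)"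
    define h where "h = (\<lambda>w. u (w i) * v (w j) + - 1)"
    have U': "\<forall>k\<in>I. openin (zar (X k)) (U' k)" using UV(1,2) by (simp add: U'_def)
    have U'_vals: "U' i = U" "U' j = V" using ij(3) by (simp_all add: U'_def)
    have h: "h \<in> product_functions X I U'"
      unfolding h_def product_functions_def
      by (intro generated_algebra.add generated_algebra.mult generated_algebra.const generated_algebra.gen)
        (use ij UV(5,6) U'_vals in auto)
    \<comment> \<open>This basic open set avoids the diagonal, on which \<open>h\<close> vanishes.\<close>
    have opn: "openin (zar ?P) {w \<in> Pi\<^sub>E I U'. h w \<noteq> 0}"
      unfolding product_variety_def fspace.select_convs
      by (intro topology_generated_by_Basis CollectI exI[of _ U'] exI[of _ h]) (simp add: U' h)
    have "x \<in> {w \<in> Pi\<^sub>E I U'. h w \<noteq> 0}"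
      using x(1) UV(3,4,7) by (auto simp: U'_def h_def PiE_iff)
    moreover have "w i \<noteq> w j" if "w \<in> Pi\<^sub>E I U'" "h w \<noteq> 0" for w
    proof
      assume "w i = w j"
      moreover have "w i \<in> U" "w j \<in> V" using that(1) ij(1,2) U'_vals by (auto simp: PiE_iff)
      ultimately show False using that(2) UV(8) by (simp add: h_def)
    qed
    moreover have "{w \<in> Pi\<^sub>E I U'. h w \<noteq> 0} \<subseteq> points ?P" by (rule openin_subset[OF opn])
    ultimately show ?thesis
      using opn by (intro exI[of _ "{w \<in> Pi\<^sub>E I U'. h w \<noteq> 0}"] conjI subsetI CollectI) auto
  qed
  then have "openin (zar ?P) {x \<in> points ?P. x i \<noteq> x j}"
    using openin_subopen[of "zar ?P" "{x \<in> points ?P. x i \<noteq> x j}"] by blast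
  moreover have "points ?P - {x \<in> points ?P. x i = x j} = {x \<in> points ?P. x i \<noteq> x j}" by auto
  ultimately show ?thesis by (simp add: closedin_def)
qed

section \<open>Morphisms between induced structures and between products\<close>

text \<open>
  The restriction axiom of a presheaf; it is a property of the spaces constructed here and is not built
  into the type of spaces with functions.
\<close>

definition restricting :: "'a fspace \<Rightarrow> bool" where
  "restricting X \<longleftrightarrow> (\<forall>U V. V \<subseteq> U \<longrightarrow> reg X U \<subseteq> reg X V)"

lemma restrictingD: "restricting X \<Longrightarrow> V \<subseteq> U \<Longrightarrow> f \<in> reg X U \<Longrightarrow> f \<in> reg X V"
  unfolding restricting_def by (rule subsetD) simp_all

lemma restricting_induced: "restricting (induced X Z)"
  unfolding restricting_def
proof (intro allI impI subsetI)
  fix U V f assume "V \<subseteq> U" and f: "f \<in> reg (induced X Z) U"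
  show "f \<in> reg (induced X Z) V"
  proof (rule reg_inducedI)
    fix x assume "x \<in> V"
    then have "x \<in> U" using \<open>V \<subseteq> U\<close> by blast
    from reg_inducedD[OF f this] obtain W g where
      "openin (zar X) W" "x \<in> W" "g \<in> reg X W" "\<forall>y\<in>U \<inter> W. f y = g y"
      by (elim exE conjE)
    with \<open>V \<subseteq> U\<close> show "\<exists>W g. openin (zar X) W \<and> x \<in> W \<and> g \<in> reg X W \<and> (\<forall>y\<in>V \<inter> W. f y = g y)"
      by (intro exI[of _ W] exI[of _ g]) auto
  qed
qed

lemma restricting_quotient_variety: "restricting X \<Longrightarrow> restricting (quotient_variety X \<pi>)"
  unfolding restricting_def quotient_variety_def fspace.select_convs
proof (intro allI impI subsetI CollectI)
  fix U V f
  assume restr: "\<forall>U V. V \<subseteq> U \<longrightarrow> reg X U \<subseteq> reg X V" and "V \<subseteq> U"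
    and f: "f \<in> {f. f \<circ> \<pi> \<in> reg X {x \<in> points X. \<pi> x \<in> U}}"
  have "{x \<in> points X. \<pi> x \<in> V} \<subseteq> {x \<in> points X. \<pi> x \<in> U}" using \<open>V \<subseteq> U\<close> by auto
  then show "f \<circ> \<pi> \<in> reg X {x \<in> points X. \<pi> x \<in> V}"
    by (rule subsetD[OF restr[rule_format] CollectD[OF f]])
qed

lemma restricting_product_variety: "restricting (product_variety I X)"
  unfolding restricting_def product_variety_def fspace.select_convs
proof (intro allI impI subsetI CollectI ballI)
  fix U V f x assume "V \<subseteq> U" "x \<in> V"
    and f: "f \<in> {f. \<forall>x\<in>U. \<exists>U'. (\<forall>i\<in>I. openin (zar (X i)) (U' i)) \<and> x \<in> Pi\<^sub>E I U' \<and>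
      (\<exists>p\<in>product_functions X I U'. \<exists>q\<in>product_functions X I U'. q x \<noteq> 0 \<and>
        (\<forall>y\<in>U \<inter> Pi\<^sub>E I U'. q y \<noteq> 0 \<longrightarrow> f y = p y / q y))}"
  then have "x \<in> U" by blast
  from bspec[OF CollectD[OF f] this] obtain U' p q where "\<forall>i\<in>I. openin (zar (X i)) (U' i)"
    "x \<in> Pi\<^sub>E I U'" "p \<in> product_functions X I U'" "q \<in> product_functions X I U'" "q x \<noteq> 0"
    "\<forall>y\<in>U \<inter> Pi\<^sub>E I U'. q y \<noteq> 0 \<longrightarrow> f y = p y / q y"
    by (elim exE conjE bexE)
  with \<open>V \<subseteq> U\<close> show "\<exists>U'. (\<forall>i\<in>I. openin (zar (X i)) (U' i)) \<and> x \<in> Pi\<^sub>E I U' \<and>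
      (\<exists>p\<in>product_functions X I U'. \<exists>q\<in>product_functions X I U'. q x \<noteq> 0 \<and>
        (\<forall>y\<in>V \<inter> Pi\<^sub>E I U'. q y \<noteq> 0 \<longrightarrow> f y = p y / q y))"
    by (intro exI[of _ U'] conjI bexI[of _ p] bexI[of _ q]) auto
qed

lemma morphism_continuous: "morphism X Y \<phi> \<Longrightarrow> continuous_map (zar X) (zar Y) \<phi>"
  by (simp add: morphism_def)

lemma morphism_reg:
  "morphism X Y \<phi> \<Longrightarrow> openin (zar Y) V \<Longrightarrow> f \<in> reg Y V \<Longrightarrow> f \<circ> \<phi> \<in> reg X {x \<in> points X. \<phi> x \<in> V}"
  by (simp add: morphism_def)

lemma morphism_id: "morphism X X (\<lambda>x. x)"
  unfolding morphism_def
proof (intro conjI allI impI)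
  fix V f assume "openin (zar X) V \<and> f \<in> reg X V"
  moreover from this have "{x \<in> points X. x \<in> V} = V" using openin_subset[of "zar X" V] by auto
  ultimately show "f \<circ> (\<lambda>x. x) \<in> reg X {x \<in> points X. x \<in> V}" by (simp add: comp_def)
qed simp

lemma morphism_compose:
  assumes "morphism X Y \<phi>" and "morphism Y Z \<psi>"
  shows "morphism X Z (\<psi> \<circ> \<phi>)"
  unfolding morphism_def
proof (intro conjI allI impI)
  show "continuous_map (zar X) (zar Z) (\<psi> \<circ> \<phi>)"
    using assms by (auto simp: morphism_def intro: continuous_map_compose)
  fix V f assume V: "openin (zar Z) V \<and> f \<in> reg Z V"
  let ?W = "{y \<in> points Y. \<psi> y \<in> V}"
  have "openin (zar Y) ?W"
    using assms(2) V by (auto simp: morphism_def intro: openin_continuous_map_preimage)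
  moreover have "f \<circ> \<psi> \<in> reg Y ?W" using assms(2) V by (intro morphism_reg) auto
  ultimately have "(f \<circ> \<psi>) \<circ> \<phi> \<in> reg X {x \<in> points X. \<phi> x \<in> ?W}" by (rule morphism_reg[OF assms(1)])
  moreover have "{x \<in> points X. \<phi> x \<in> ?W} = {x \<in> points X. (\<psi> \<circ> \<phi>) x \<in> V}"
    using continuous_map_image_subset_topspace[OF morphism_continuous[OF assms(1)]] by auto
  ultimately show "f \<circ> (\<psi> \<circ> \<phi>) \<in> reg X {x \<in> points X. (\<psi> \<circ> \<phi>) x \<in> V}"
    by (simp add: comp_assoc)
qed

lemma morphism_induced_inclusion: "morphism (induced X Z) X (\<lambda>x. x)"
  unfolding morphism_def
proof (intro conjI allI impI)
  show "continuous_map (zar (induced X Z)) (zar X) (\<lambda>x. x)"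
    by (simp add: induced_def continuous_map_from_subtopology)
  fix V f assume "openin (zar X) V \<and> f \<in> reg X V"
  then show "f \<circ> (\<lambda>x. x) \<in> reg (induced X Z) {x \<in> points (induced X Z). x \<in> V}"
    by (intro reg_inducedI exI[of _ V] exI[of _ f]) (simp add: comp_def)
qed

text \<open>
  The source is required to be an induced structure because a function on \<open>induced Y Z\<close> is only locally
  the restriction of a regular function on \<open>Y\<close>. Its pullback is therefore only locally regular, which
  suffices in an induced structure, whose regular functions are defined by a local condition.
\<close>

lemma morphism_into_induced:
  assumes \<phi>: "morphism (induced X W) Y \<phi>" and "restricting X"
    and image: "\<And>x. x \<in> points X \<Longrightarrow> x \<in> W \<Longrightarrow> \<phi> x \<in> Z"
  shows "morphism (induced X W) (induced Y Z) \<phi>"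
  unfolding morphism_def
proof (intro conjI allI impI)
  show "continuous_map (zar (induced X W)) (zar (induced Y Z)) \<phi>"
    using morphism_continuous[OF \<phi>] image
    by (auto simp: induced_def continuous_map_in_subtopology)
  fix V f assume *: "openin (zar (induced Y Z)) V \<and> f \<in> reg (induced Y Z) V"
  show "f \<circ> \<phi> \<in> reg (induced X W) {x \<in> points (induced X W). \<phi> x \<in> V}" (is "_ \<in> reg _ ?U")
  proof (rule reg_inducedI)
    fix x assume x: "x \<in> ?U"
    then have "x \<in> W" by (simp add: induced_def)
    obtain V1 g where V1: "openin (zar Y) V1" "\<phi> x \<in> V1" "g \<in> reg Y V1" "\<forall>y\<in>V \<inter> V1. f y = g y"
      using reg_inducedD[OF conjunct2[OF *], of "\<phi> x"] x by (auto elim!: exE)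
    let ?U1 = "{x \<in> points (induced X W). \<phi> x \<in> V1}"
    have "x \<in> ?U1" using x V1(2) by simp
    from reg_inducedD[OF morphism_reg[OF \<phi> V1(1,3)] this] obtain V2 g' where
      V2: "openin (zar X) V2" "x \<in> V2" "g' \<in> reg X V2" "\<forall>y\<in>?U1 \<inter> V2. (g \<circ> \<phi>) y = g' y"
      by (elim exE conjE)
    have "openin (zar (induced X W)) ?U1"
      using morphism_continuous[OF \<phi>] V1(1) by (rule openin_continuous_map_preimage)
    then obtain V3 where V3: "openin (zar X) V3" "?U1 = V3 \<inter> W"
      unfolding induced_def fspace.select_convs openin_subtopology by (elim exE conjE)
    have "x \<in> V3" using V3(2) \<open>x \<in> ?U1\<close> by blast
    have "g' \<in> reg X (V2 \<inter> V3)"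
      by (rule restrictingD[OF \<open>restricting X\<close> _ V2(3)]) simp
    moreover have "\<forall>y\<in>?U \<inter> (V2 \<inter> V3). (f \<circ> \<phi>) y = g' y"
    proof
      fix y assume y: "y \<in> ?U \<inter> (V2 \<inter> V3)"
      then have "y \<in> V3 \<inter> W" by (simp add: induced_def)
      then have "y \<in> ?U1" using V3(2) by simp
      then show "(f \<circ> \<phi>) y = g' y" using y V1(4) V2(4) by simp
    qed
    ultimately show "\<exists>V' g. openin (zar X) V' \<and> x \<in> V' \<and> g \<in> reg X V' \<and>
      (\<forall>y\<in>?U \<inter> V'. (f \<circ> \<phi>) y = g y)"
      using V2(1,2) V3(1) \<open>x \<in> V3\<close>
      by (intro exI[of _ "V2 \<inter> V3"] exI[of _ g'] conjI openin_Int) simp_all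
  qed
qed

lemma morphism_induced_induced:
  assumes "morphism X Y \<phi>" and "restricting X"
    and "\<And>x. x \<in> points X \<Longrightarrow> x \<in> W \<Longrightarrow> \<phi> x \<in> Z"
  shows "morphism (induced X W) (induced Y Z) \<phi>"
  using morphism_compose[OF morphism_induced_inclusion assms(1), of W] assms(2,3)
  by (intro morphism_into_induced) (simp_all add: comp_def)

lemma preimage_nonvanishing:
  assumes "A \<subseteq> C" and "\<And>x. x \<in> C \<Longrightarrow> x \<in> A \<longleftrightarrow> \<rho> x \<in> B"
  shows "{x \<in> A. h (\<rho> x) \<noteq> 0} = \<rho> -` {x \<in> B. h x \<noteq> 0} \<inter> C"
  using assms by auto

text \<open>
  Permuting, omitting or repeating factors of a product is a morphism. The factor \<open>k\<close> of the target is only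
  required to contain the factor \<open>\<sigma> k\<close> of the source compatibly with the structures, which allows a
  component in a subvariety to be copied into the ambient variety. A box \<open>U'\<close> in the target pulls back to
  the box \<open>pull U'\<close> whose side at \<open>i\<close> is the intersection of the sides at all \<open>k\<close> with \<open>\<sigma> k = i\<close>.
\<close>

lemma morphism_reindex:
  fixes X :: "'i \<Rightarrow> 'a fspace" and X' :: "'k \<Rightarrow> 'a fspace"
  assumes "finite I'" and \<sigma>: "\<And>k. k \<in> I' \<Longrightarrow> \<sigma> k \<in> I"
    and incl: "\<And>k. k \<in> I' \<Longrightarrow> morphism (X (\<sigma> k)) (X' k) (\<lambda>x. x)"
    and restr: "\<And>i. i \<in> I \<Longrightarrow> restricting (X i)"
  shows "morphism (product_variety I X) (product_variety I' X') (\<lambda>x. \<lambda>k\<in>I'. x (\<sigma> k))"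
proof -
  let ?P = "product_variety I X" and ?P' = "product_variety I' X'"
  define \<rho> :: "('i \<Rightarrow> 'a) \<Rightarrow> 'k \<Rightarrow> 'a" where "\<rho> = (\<lambda>x. \<lambda>k\<in>I'. x (\<sigma> k))"
  define pull where "pull = (\<lambda>U' i. {x \<in> points (X i). \<forall>k\<in>I'. \<sigma> k = i \<longrightarrow> x \<in> (U' k :: 'a set)})"
  have pull_open: "openin (zar (X i)) (pull U' i)"
    if U': "\<forall>k\<in>I'. openin (zar (X' k)) (U' k)" for U' i
  proof -
    have "pull U' i = (\<Inter>k\<in>{k \<in> I'. \<sigma> k = i}. {x \<in> points (X i). x \<in> U' k}) \<inter> points (X i)"
      by (auto simp: pull_def)
    moreover have "openin (zar (X i)) {x \<in> points (X i). x \<in> U' k}" if "k \<in> I'" "\<sigma> k = i" for k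
      using openin_continuous_map_preimage[OF morphism_continuous[OF incl[OF that(1)]]] U' that by auto
    ultimately show ?thesis
      using \<open>finite I'\<close> by (cases "{k \<in> I'. \<sigma> k = i} = {}") (auto intro!: openin_Int openin_INT)
  qed
  have in_pull: "x \<in> Pi\<^sub>E I (pull U') \<longleftrightarrow> \<rho> x \<in> Pi\<^sub>E I' U'" if "x \<in> points ?P" for x U'
    using that \<sigma> by (auto simp: points_product_variety PiE_iff pull_def \<rho>_def)
  have pull_functions: "(\<lambda>x. h (\<rho> x)) \<in> product_functions X I (pull U')"
    if U': "\<forall>k\<in>I'. openin (zar (X' k)) (U' k)" and h: "h \<in> product_functions X' I' U'" for U' h
    unfolding product_functions_def
  proof (rule generated_algebra_comp[OF h[unfolded product_functions_def]])
    fix f assume "f \<in> {\<lambda>x. f (x i) | i f. i \<in> I' \<and> f \<in> reg (X' i) (U' i)}"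
    then obtain k e where e: "f = (\<lambda>x. e (x k))" "k \<in> I'" "e \<in> reg (X' k) (U' k)" by blast
    have "e \<circ> (\<lambda>x. x) \<in> reg (X (\<sigma> k)) {x \<in> points (X (\<sigma> k)). x \<in> U' k}"
      by (rule morphism_reg[OF incl]) (use e U' in auto)
    moreover have "pull U' (\<sigma> k) \<subseteq> {x \<in> points (X (\<sigma> k)). x \<in> U' k}"
      using e(2) by (auto simp: pull_def)
    ultimately have "e \<in> reg (X (\<sigma> k)) (pull U' (\<sigma> k))"
      using restrictingD[OF restr[OF \<sigma>[OF e(2)]]] by (simp add: comp_def)
    then have "(\<lambda>x. e (x (\<sigma> k))) \<in> {\<lambda>x. f (x i) | i f. i \<in> I \<and> f \<in> reg (X i) (pull U' i)}"
      using \<sigma>[OF e(2)] by (intro CollectI exI[of _ "\<sigma> k"] exI[of _ e] conjI refl)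
    from generated_algebra.gen[OF this]
    show "(\<lambda>x. f (\<rho> x)) \<in> generated_algebra {\<lambda>x. f (x i) | i f. i \<in> I \<and> f \<in> reg (X i) (pull U' i)}"
      by (simp add: e(1,2) \<rho>_def)
  qed
  have into: "\<rho> x \<in> points ?P'" if "x \<in> points ?P" for x
  proof -
    have "x (\<sigma> k) \<in> points (X' k)" if "k \<in> I'" for k
      using continuous_map_image_subset_topspace[OF morphism_continuous[OF incl[OF that]]]
        \<open>x \<in> points ?P\<close> \<sigma>[OF that] by (auto simp: points_product_variety PiE_iff)
    then show ?thesis by (simp add: points_product_variety \<rho>_def)
  qed
  have cont: "continuous_map (zar ?P) (zar ?P') \<rho>"
  proof -
    let ?S = "{{x \<in> Pi\<^sub>E I' U. h x \<noteq> 0} | U h.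
          (\<forall>i\<in>I'. openin (zar (X' i)) (U i)) \<and> h \<in> product_functions X' I' U}"
    have S: "zar ?P' = topology_generated_by ?S" by (simp add: product_variety_def)
    have "openin (zar ?P) (\<rho> -` A \<inter> points ?P)" if AS: "A \<in> ?S" for A
    proof -
      obtain U h where A: "A = {x \<in> Pi\<^sub>E I' U. h x \<noteq> 0}" "\<forall>i\<in>I'. openin (zar (X' i)) (U i)"
        "h \<in> product_functions X' I' U" using AS by (elim CollectE exE conjE)
      have "openin (zar ?P) {x \<in> Pi\<^sub>E I (pull U). h (\<rho> x) \<noteq> 0}"
        unfolding product_variety_def fspace.select_convs
        by (intro topology_generated_by_Basis CollectI exI[of _ "pull U"] exI[of _ "\<lambda>x. h (\<rho> x)"])
          (simp add: pull_open[OF A(2)] pull_functions[OF A(2,3)])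
      moreover have "{x \<in> Pi\<^sub>E I (pull U). h (\<rho> x) \<noteq> 0} = \<rho> -` A \<inter> points ?P"
        unfolding A(1)
      proof (rule preimage_nonvanishing)
        show "Pi\<^sub>E I (pull U) \<subseteq> points ?P"
          unfolding points_product_variety pull_def by (rule PiE_mono) auto
      qed (rule in_pull)
      ultimately show ?thesis by simp
    qed
    moreover have "\<rho> ` points ?P \<subseteq> points ?P'"
      using into by (rule image_subsetI)
    ultimately show ?thesis
      unfolding S topology_generated_by_topspace by (rule continuous_on_generated_topo)
  qed
  have "f \<circ> \<rho> \<in> reg ?P {x \<in> points ?P. \<rho> x \<in> V}" if f: "f \<in> reg ?P' V" for V f
  proof -
    have "\<exists>U. (\<forall>i\<in>I. openin (zar (X i)) (U i)) \<and> x \<in> Pi\<^sub>E I U \<and>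
                  (\<exists>p\<in>product_functions X I U. \<exists>q\<in>product_functions X I U. q x \<noteq> 0 \<and>
                     (\<forall>y\<in>{x \<in> points ?P. \<rho> x \<in> V} \<inter> Pi\<^sub>E I U. q y \<noteq> 0 \<longrightarrow> (f \<circ> \<rho>) y = p y / q y))"
      if x: "x \<in> points ?P" "\<rho> x \<in> V" for x
    proof -
      have "\<forall>x\<in>V. \<exists>U. (\<forall>i\<in>I'. openin (zar (X' i)) (U i)) \<and> x \<in> Pi\<^sub>E I' U \<and>
                  (\<exists>p\<in>product_functions X' I' U. \<exists>q\<in>product_functions X' I' U. q x \<noteq> 0 \<and>
                     (\<forall>y\<in>V \<inter> Pi\<^sub>E I' U. q y \<noteq> 0 \<longrightarrow> f y = p y / q y))"
        using f unfolding product_variety_def by simp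
      from bspec[OF this x(2)] obtain U p q where U: "\<forall>i\<in>I'. openin (zar (X' i)) (U i)"
        and pq: "\<rho> x \<in> Pi\<^sub>E I' U" "p \<in> product_functions X' I' U" "q \<in> product_functions X' I' U"
        "q (\<rho> x) \<noteq> 0" "\<forall>y\<in>V \<inter> Pi\<^sub>E I' U. q y \<noteq> 0 \<longrightarrow> f y = p y / q y"
        by (elim exE conjE bexE)
      show ?thesis
      proof (rule exI[of _ "pull U"], intro conjI)
        show "\<forall>i\<in>I. openin (zar (X i)) (pull U i)" using pull_open[OF U] by simp
        show "x \<in> Pi\<^sub>E I (pull U)" using in_pull[OF x(1)] pq(1) by simp
        show "\<exists>p\<in>product_functions X I (pull U). \<exists>q\<in>product_functions X I (pull U). q x \<noteq> 0 \<and>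
            (\<forall>y\<in>{x \<in> points ?P. \<rho> x \<in> V} \<inter> Pi\<^sub>E I (pull U). q y \<noteq> 0 \<longrightarrow> (f \<circ> \<rho>) y = p y / q y)"
        proof (rule bexI[OF _ pull_functions[OF U pq(2)]], rule bexI[OF _ pull_functions[OF U pq(3)]],
            intro conjI ballI impI)
          show "q (\<rho> x) \<noteq> 0" by (rule pq(4))
          fix y assume y: "y \<in> {x \<in> points ?P. \<rho> x \<in> V} \<inter> Pi\<^sub>E I (pull U)" and "q (\<rho> y) \<noteq> 0"
          have "\<rho> y \<in> V \<inter> Pi\<^sub>E I' U" using y in_pull[of y U] by simp
          then show "(f \<circ> \<rho>) y = p (\<rho> y) / q (\<rho> y)"
            using pq(5) \<open>q (\<rho> y) \<noteq> 0\<close> by simp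
        qed
      qed
    qed
    then show ?thesis unfolding product_variety_def by simp
  qed
  with cont show ?thesis unfolding morphism_def \<rho>_def by simp
qed

lemma isomorphismI:
  assumes "morphism X Y \<phi>" and "morphism Y X \<psi>"
    and "\<And>x. x \<in> points X \<Longrightarrow> \<psi> (\<phi> x) = x" and "\<And>y. y \<in> points Y \<Longrightarrow> \<phi> (\<psi> y) = y"
  shows "isomorphism X Y \<phi>"
  unfolding isomorphism_def using assms by (intro conjI exI[of _ \<psi>]) simp_all

section \<open>Positions kept by a subword\<close>

text \<open>
  The inverse renumbering: each position of \<open>P\<close>, kept or not, is sent to the number of the first kept
  position that is not before it.
\<close>

definition collapsed_position :: "nat option list \<Rightarrow> nat \<Rightarrow> nat" where
  "collapsed_position P i = length (flat (take (i - 1) P)) + 1"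

lemma flat_snoc: "flat (P @ [\<beta>]) = flat P @ (if \<beta> = None then [] else [the \<beta>])"
  by (simp add: flat_def)

lemma kept_positions_snoc:
  "filter (\<lambda>i. (P @ [\<beta>]) ! (i - 1) \<noteq> None) [1..<length (P @ [\<beta>]) + 1] =
   filter (\<lambda>i. P ! (i - 1) \<noteq> None) [1..<length P + 1] @ (if \<beta> = None then [] else [length P + 1])"
proof -
  have "filter (\<lambda>i. (P @ [\<beta>]) ! (i - 1) \<noteq> None) [1..<length P + 1] =
      filter (\<lambda>i. P ! (i - 1) \<noteq> None) [1..<length P + 1]"
    by (rule filter_cong) (auto simp: nth_append)
  then show ?thesis by (simp add: nth_append)
qed

lemma length_kept_positions:
  "length (filter (\<lambda>i. P ! (i - 1) \<noteq> None) [1..<length P + 1]) = length (flat P)"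
proof (induction P rule: rev_induct)
  case Nil
  show ?case by (simp add: flat_def)
next
  case (snoc \<beta> P)
  then show ?case unfolding kept_positions_snoc flat_snoc by simp
qed

lemma kept_positions_last: "kept_positions P ! length (flat P) = length P + 1"
  unfolding kept_positions_def length_kept_positions[symmetric] by (rule nth_append_length)

lemma kept_positions_nth:
  assumes "j < length (flat P)"
  shows "kept_positions P ! j = filter (\<lambda>i. P ! (i - 1) \<noteq> None) [1..<length P + 1] ! j"
  unfolding kept_positions_def using assms length_kept_positions[of P] by (simp add: nth_append)

lemma kept_position:
  assumes "k \<in> {1..length (flat P)}"
  defines "i \<equiv> kept_positions P ! (k - 1)"
  shows "i \<in> {1..length P}" "P ! (i - 1) \<noteq> None"
    "collapsed_position P i = k" "flat P ! (k - 1) = the (P ! (i - 1))"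
proof -
  have "i \<in> {1..length P} \<and> P ! (i - 1) \<noteq> None \<and>
    length (flat (take (i - 1) P)) = j \<and> flat P ! j = the (P ! (i - 1))"
    if "j < length (flat P)" "i = filter (\<lambda>i. P ! (i - 1) \<noteq> None) [1..<length P + 1] ! j" for i j
    using that
  proof (induction P arbitrary: i j rule: rev_induct)
    case Nil
    then show ?case by (simp add: flat_def)
  next
    case (snoc \<beta> P)
    show ?case
    proof (cases "j < length (flat P)")
      case True
      then have "i = filter (\<lambda>i. P ! (i - 1) \<noteq> None) [1..<length P + 1] ! j"
        using snoc.prems(2) length_kept_positions[of P]
        unfolding kept_positions_snoc by (simp add: nth_append)
      from snoc.IH[OF True this] show ?thesis
        using True by (auto simp: nth_append flat_snoc)
    next
      case False
      then obtain b where b: "\<beta> = Some b" and j: "j = length (flat P)"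
        using snoc.prems(1) by (cases \<beta>) (auto simp: flat_snoc)
      have "i = length P + 1"
        using snoc.prems(2) length_kept_positions[of P]
        unfolding kept_positions_snoc j b by (simp add: nth_append)
      then show ?thesis by (simp add: flat_snoc nth_append b j)
    qed
  qed
  moreover have k: "k - 1 < length (flat P)" "k - 1 + 1 = k" using assms(1) by auto
  ultimately have *: "i \<in> {1..length P} \<and> P ! (i - 1) \<noteq> None \<and>
      length (flat (take (i - 1) P)) = k - 1 \<and> flat P ! (k - 1) = the (P ! (i - 1))"
    unfolding i_def kept_positions_nth[OF k(1)] by blast
  then show "i \<in> {1..length P}" "P ! (i - 1) \<noteq> None" "flat P ! (k - 1) = the (P ! (i - 1))"
    by blast+
  show "collapsed_position P i = k"
    unfolding collapsed_position_def using * k(2) by simp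
qed

lemma length_flat_mono: "length (flat (take i P)) \<le> length (flat P)"
proof -
  have "flat (take i P @ drop i P) = flat (take i P) @ flat (drop i P)"
    by (simp only: flat_def filter_append map_append)
  then show ?thesis by simp
qed

lemma collapsed_position_range:
  "collapsed_position P i \<in> {1..length (flat P) + 1}"
  using length_flat_mono by (simp add: collapsed_position_def)

lemma collapsed_position_last: "collapsed_position P (length P + 1) = length (flat P) + 1"
  by (simp add: collapsed_position_def)

lemma collapsed_position_Suc:
  assumes "i \<in> {1..length P}"
  shows "collapsed_position P (i + 1) =
    (if P ! (i - 1) = None then collapsed_position P i else collapsed_position P i + 1)"
proof -
  have "take i P = take (i - 1) P @ [P ! (i - 1)]"
    using assms by (cases i) (auto simp: take_Suc_conv_app_nth)
  then show ?thesis by (simp add: collapsed_position_def flat_snoc)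
qed

lemma kept_positions_collapsed_position:
  assumes "i \<in> {1..length P}" "P ! (i - 1) \<noteq> None"
  shows "kept_positions P ! (collapsed_position P i - 1) = i"
proof -
  let ?j = "length (flat (take (i - 1) P))"
  have "?j < length (flat P) \<and> filter (\<lambda>i. P ! (i - 1) \<noteq> None) [1..<length P + 1] ! ?j = i"
    using assms
  proof (induction P rule: rev_induct)
    case (snoc \<beta> P)
    show ?case
    proof (cases "i = length P + 1")
      case True
      then show ?thesis
        using snoc.prems(2) length_kept_positions[of P]
        unfolding kept_positions_snoc by (simp add: flat_snoc nth_append)
    next
      case False
      then have i: "i \<in> {1..length P}" "P ! (i - 1) \<noteq> None"
        using snoc.prems by (auto simp: nth_append split: if_splits)
      have "take (i - 1) (P @ [\<beta>]) = take (i - 1) P" using i(1) by simp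
      then show ?thesis
        using snoc.IH[OF i] length_kept_positions[of P]
        unfolding kept_positions_snoc by (simp add: flat_snoc nth_append)
    qed
  qed simp
  then show ?thesis using kept_positions_nth[of ?j P] by (simp add: collapsed_position_def)
qed

text \<open>
  The components at a run of deleted positions all agree with the one at the next kept position; since
  \<open>length P + 1\<close> is always kept, the induction descends from there.
\<close>

lemma constant_on_deleted_runs:
  assumes eq: "\<And>i. i \<in> {1..length P} \<Longrightarrow> P ! (i - 1) = None \<Longrightarrow> x i = x (i + 1)"
    and i: "i \<in> {1..length P + 1}"
  shows "x (kept_positions P ! (collapsed_position P i - 1)) = x i"
proof -
  have "i \<le> length P + 1" "1 \<le> i" using i by auto
  then show ?thesis
  proof (induction rule: inc_induct)
    case base
    show ?case using kept_positions_last[of P] collapsed_position_last[of P] by simp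
  next
    case (step n)
    then have n: "n \<in> {1..length P}" by simp
    show ?case
    proof (cases "P ! (n - 1) = None")
      case True
      then have "collapsed_position P n = collapsed_position P (Suc n)"
        using collapsed_position_Suc[OF n] by simp
      then show ?thesis using step eq[OF n True] by simp
    next
      case False
      then show ?thesis using kept_positions_collapsed_position[OF n] by simp
    qed
  qed
qed

section \<open>Strata of Barbasch-Evens-Magyar varieties\<close>

lemma restricting_flag_variety: "restricting (flag_variety G B)"
  unfolding flag_variety_def by (intro restricting_quotient_variety restricting_induced)

text \<open>
  The last component is constrained to lie in \<open>Y\<close>, so it has to come from the last component; any component
  may be placed at an unconstrained position.
\<close>

lemma morphism_BEM_ambient_reindex:
  assumes \<sigma>: "\<And>k. k \<in> {1..M + 1} \<Longrightarrow> \<sigma> k \<in> {1..N + 1}" and last: "\<sigma> (M + 1) = N + 1"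
  shows "morphism (BEM_ambient G B Y N) (BEM_ambient G B Y M) (\<lambda>x. \<lambda>k\<in>{1..M + 1}. x (\<sigma> k))"
  unfolding BEM_ambient_def
proof (rule morphism_reindex)
  show "\<sigma> k \<in> {1..N + 1}" if "k \<in> {1..M + 1}" for k using \<sigma> that .
  show "morphism (if \<sigma> k = N + 1 then induced (flag_variety G B) Y else flag_variety G B)
      (if k = M + 1 then induced (flag_variety G B) Y else flag_variety G B) (\<lambda>x. x)" for k
    using last by (auto intro: morphism_id morphism_induced_inclusion)
qed (auto intro: restricting_flag_variety restricting_induced)

lemma points_BEM: "points (BEM G B Par Y Q) = BEM_set G B Par Y Q"
  by (auto simp: BEM_def induced_def BEM_set_def)

lemma BEM_ambient_diagonal_closed:
  assumes "subgroup G GL" and "algebraic_group B" and "i \<in> {1..N}"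
  shows "closedin (zar (BEM_ambient G B Y N)) {x \<in> points (BEM_ambient G B Y N). x i = x (i + 1)}"
  unfolding BEM_ambient_def
  by (rule closedin_product_variety_diagonal)
    (use assms flag_variety_separated[OF assms(1,2)] in \<open>auto intro: function_separated_induced\<close>)

lemma stratum_closed:
  assumes "subgroup G GL" and "algebraic_group B"
  shows "closedin (zar (BEM G B Par Y Q)) (stratum G B Par Y Q P)"
proof -
  let ?A = "BEM_ambient G B Y (length Q)" and ?Z = "BEM_set G B Par Y Q"
  let ?D = "\<lambda>i. {x \<in> points ?A. x i = x (i + 1)}"
  let ?K = "insert (points ?A) (?D ` {i \<in> {1..length Q}. P ! (i - 1) = None})"
  have "closedin (zar ?A) (\<Inter> ?K)"
    by (rule closedin_Inter) (use BEM_ambient_diagonal_closed[OF assms] in auto)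
  moreover have "stratum G B Par Y Q P = \<Inter> ?K \<inter> ?Z"
    unfolding stratum_def points_BEM by (auto simp: BEM_set_def)
  ultimately show ?thesis
    unfolding BEM_def induced_def by (auto simp: closedin_subtopology)
qed

text \<open>
  Each symbol \<open>-\<close> stands for one equation, so intersecting two strata amounts to uniting the sets of
  their deleted positions.
\<close>

lemma stratum_Int:
  assumes "P \<in> subwords Q" and "P' \<in> subwords Q"
  shows "\<exists>R\<in>subwords Q. stratum G B Par Y Q P \<inter> stratum G B Par Y Q P' = stratum G B Par Y Q R"
proof
  let ?R = "map (\<lambda>i. if P ! i = None then None else P' ! i) [0..<length Q]"
  show "?R \<in> subwords Q" using assms by (auto simp: subwords_def)
  have "?R ! (i - 1) = None \<longleftrightarrow> P ! (i - 1) = None \<or> P' ! (i - 1) = None"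
    if "i \<in> {1..length Q}" for i
  proof -
    have "i - 1 < length Q" using that by auto
    then show ?thesis by (cases "P ! (i - 1)") simp_all
  qed
  then show "stratum G B Par Y Q P \<inter> stratum G B Par Y Q P' = stratum G B Par Y Q ?R"
    unfolding stratum_def by auto
qed

lemma BEM_stratification:
  assumes "subgroup G GL" and "algebraic_group B"
  shows "stratification_by_closed_subvarieties (BEM G B Par Y Q) (subwords Q) (stratum G B Par Y Q)"
  unfolding stratification_by_closed_subvarieties_def
proof (intro conjI ballI)
  have "map Some Q \<in> subwords Q" by (simp add: subwords_def)
  moreover have "stratum G B Par Y Q (map Some Q) = points (BEM G B Par Y Q)"
    by (auto simp: stratum_def)
  moreover have "stratum G B Par Y Q P \<subseteq> points (BEM G B Par Y Q)" for P
    by (auto simp: stratum_def)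
  ultimately show "points (BEM G B Par Y Q) = (\<Union>P\<in>subwords Q. stratum G B Par Y Q P)"
    by blast
next
  fix P P' assume "P \<in> subwords Q" "P' \<in> subwords Q"
  then obtain R where "R \<in> subwords Q"
    "stratum G B Par Y Q P \<inter> stratum G B Par Y Q P' = stratum G B Par Y Q R"
    using stratum_Int by blast
  then show "\<exists>J\<subseteq>subwords Q. stratum G B Par Y Q P \<inter> stratum G B Par Y Q P' =
      (\<Union>R\<in>J. stratum G B Par Y Q R)"
    by (intro exI[of _ "{R}"]) simp
qed (rule stratum_closed[OF assms])

text \<open>
  The inverse of the deletion \<open>x \<mapsto> x \<circ> \<sigma>\<close> is \<open>y \<mapsto> y \<circ> \<tau>\<close>, where \<open>\<tau>\<close> collapses a run of deleted positions to the
  kept position that follows it. Both maps only rearrange components, hence are morphisms. They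
  respect the incidence conditions: a letter of \<open>flat P\<close> relates \<open>x (\<sigma> k)\<close> to \<open>x (\<sigma> (k + 1))\<close>, which on the
  stratum equals \<open>x (\<sigma> k + 1)\<close>, and at a deleted position the condition for \<open>y \<circ> \<tau>\<close> relates two equal cosets.
\<close>

lemma stratum_isomorphism:
  fixes G B :: "(complex ^ 'n::finite ^ 'n) set"
  assumes P: "P \<in> subwords Q"
  shows "isomorphism (induced (BEM G B Par Y Q) (stratum G B Par Y Q P))
    (BEM G B Par Y (flat P)) (delete_components P)"
proof -
  let ?N = "length Q" and ?M = "length (flat P)"
  let ?A = "BEM_ambient G B Y ?N" and ?A' = "BEM_ambient G B Y ?M"
  let ?Z = "BEM_set G B Par Y Q" and ?Z' = "BEM_set G B Par Y (flat P)"
  let ?S = "stratum G B Par Y Q P"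
  define \<sigma> where "\<sigma> = (\<lambda>k. kept_positions P ! (k - 1))"
  define \<tau> where "\<tau> = collapsed_position P"
  define \<psi> :: "(nat \<Rightarrow> (complex ^ 'n ^ 'n) set) \<Rightarrow> nat \<Rightarrow> (complex ^ 'n ^ 'n) set"
    where "\<psi> = (\<lambda>y. \<lambda>i\<in>{1..?N + 1}. y (\<tau> i))"
  have len: "length P = ?N" and letter: "\<And>i. i < ?N \<Longrightarrow> P ! i \<in> {None, Some (Q ! i)}"
    using P by (auto simp: subwords_def)
  have \<phi>: "delete_components P = (\<lambda>x. \<lambda>k\<in>{1..?M + 1}. x (\<sigma> k))"
    by (auto simp: delete_components_def \<sigma>_def fun_eq_iff)
  have \<sigma>_last: "\<sigma> (?M + 1) = ?N + 1" using kept_positions_last[of P] len by (simp add: \<sigma>_def)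
  have \<sigma>: "\<sigma> k \<in> {1..?N}" "P ! (\<sigma> k - 1) \<noteq> None" "\<tau> (\<sigma> k) = k" "flat P ! (k - 1) = Q ! (\<sigma> k - 1)"
    if "k \<in> {1..?M}" for k
  proof -
    note kept = kept_position[OF that, folded \<sigma>_def[THEN fun_cong] \<tau>_def]
    show "\<sigma> k \<in> {1..?N}" "P ! (\<sigma> k - 1) \<noteq> None" "\<tau> (\<sigma> k) = k"
      using kept(1-3) len by (simp_all add: \<sigma>_def)
    then show "flat P ! (k - 1) = Q ! (\<sigma> k - 1)"
      using kept(4) letter[of "\<sigma> k - 1"] by (auto simp: \<sigma>_def)
  qed
  have \<sigma>_range: "\<sigma> k \<in> {1..?N + 1}" if "k \<in> {1..?M + 1}" for k
    using \<sigma>(1)[of k] \<sigma>_last that by (cases "k = ?M + 1") auto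
  have \<tau>_last: "\<tau> (?N + 1) = ?M + 1" using collapsed_position_last[of P] len by (simp add: \<tau>_def)
  have \<tau>_range: "\<tau> i \<in> {1..?M + 1}" for i unfolding \<tau>_def by (rule collapsed_position_range)
  have \<tau>\<sigma>: "\<tau> (\<sigma> k) = k" if "k \<in> {1..?M + 1}" for k
    using \<sigma>(3)[of k] \<sigma>_last \<tau>_last that by (cases "k = ?M + 1") auto
  have \<tau>_Suc: "\<tau> (i + 1) = (if P ! (i - 1) = None then \<tau> i else \<tau> i + 1)" if "i \<in> {1..?N}" for i
    using collapsed_position_Suc[of i P] that len by (simp add: \<tau>_def)
  have \<sigma>\<tau>: "\<sigma> (\<tau> i) = i" if "i \<in> {1..?N}" "P ! (i - 1) \<noteq> None" for i
    using kept_positions_collapsed_position[of i P] that len by (simp add: \<sigma>_def \<tau>_def)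
  have \<sigma>\<tau>_stratum: "x (\<sigma> (\<tau> i)) = x i" if "x \<in> ?S" "i \<in> {1..?N + 1}" for x i
    unfolding \<sigma>_def \<tau>_def
    by (rule constant_on_deleted_runs) (use that len in \<open>auto simp: stratum_def\<close>)
  have m\<phi>: "morphism ?A ?A' (delete_components P)"
    unfolding \<phi> by (rule morphism_BEM_ambient_reindex[where \<sigma> = \<sigma>, OF _ \<sigma>_last]) (rule \<sigma>_range)
  have m\<psi>: "morphism ?A' ?A \<psi>"
    unfolding \<psi>_def by (rule morphism_BEM_ambient_reindex[where \<sigma> = \<tau>, OF _ \<tau>_last]) (rule \<tau>_range)
  have \<phi>_image: "delete_components P x \<in> ?Z'" if x: "x \<in> ?S" for x
  proof -
    have xZ: "x \<in> ?Z" using x by (simp add: stratum_def points_BEM)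
    have "delete_components P x \<in> points ?A'"
      using continuous_map_image_subset_topspace[OF morphism_continuous[OF m\<phi>]] xZ
      by (auto simp: BEM_set_def)
    moreover have "delete_components P x (k + 1) <#>\<^bsub>GL\<^esub> Par (flat P ! (k - 1)) =
        delete_components P x k <#>\<^bsub>GL\<^esub> Par (flat P ! (k - 1))" if k: "k \<in> {1..?M}" for k
    proof -
      have "\<tau> (\<sigma> k + 1) = k + 1" using \<tau>_Suc[OF \<sigma>(1)[OF k]] \<sigma>(2,3)[OF k] by simp
      then have "x (\<sigma> (k + 1)) = x (\<sigma> k + 1)"
        using \<sigma>\<tau>_stratum[OF x, of "\<sigma> k + 1"] \<sigma>(1)[OF k] by simp
      moreover have "x (\<sigma> k + 1) <#>\<^bsub>GL\<^esub> Par (Q ! (\<sigma> k - 1)) = x (\<sigma> k) <#>\<^bsub>GL\<^esub> Par (Q ! (\<sigma> k - 1))"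
        using xZ \<sigma>(1)[OF k] by (simp add: BEM_set_def)
      ultimately show ?thesis using k \<sigma>(4)[OF k] by (simp add: \<phi>)
    qed
    ultimately show ?thesis by (simp add: BEM_set_def)
  qed
  have \<psi>_image: "\<psi> y \<in> ?Z \<and> \<psi> y \<in> ?S" if y: "y \<in> ?Z'" for y
  proof -
    have "\<psi> y \<in> points ?A"
      using continuous_map_image_subset_topspace[OF morphism_continuous[OF m\<psi>]] y
      by (auto simp: BEM_set_def)
    moreover have step: "\<psi> y (i + 1) <#>\<^bsub>GL\<^esub> Par (Q ! (i - 1)) = \<psi> y i <#>\<^bsub>GL\<^esub> Par (Q ! (i - 1))"
      if i: "i \<in> {1..?N}" for i
    proof (cases "P ! (i - 1) = None")
      case True
      then show ?thesis using \<tau>_Suc[OF i] i by (simp add: \<psi>_def)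
    next
      case False
      have \<tau>: "\<tau> (i + 1) = \<tau> i + 1" using \<tau>_Suc[OF i] False by simp
      then have k: "\<tau> i \<in> {1..?M}" using \<tau>_range[of i] \<tau>_range[of "i + 1"] by simp
      have "y (\<tau> i + 1) <#>\<^bsub>GL\<^esub> Par (flat P ! (\<tau> i - 1)) = y (\<tau> i) <#>\<^bsub>GL\<^esub> Par (flat P ! (\<tau> i - 1))"
        using y k by (simp add: BEM_set_def)
      then show ?thesis
        using \<sigma>(4)[OF k] \<sigma>\<tau>[OF i False] \<tau> i by (simp add: \<psi>_def)
    qed
    ultimately have "\<psi> y \<in> ?Z" by (simp add: BEM_set_def)
    moreover have "\<psi> y i = \<psi> y (i + 1)" if "i \<in> {1..?N}" "P ! (i - 1) = None" for i
      using \<tau>_Suc[OF that(1)] that by (simp add: \<psi>_def)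
    ultimately show ?thesis by (simp add: stratum_def points_BEM)
  qed
  have points_stratum: "points (induced (BEM G B Par Y Q) ?S) = ?S"
    by (auto simp: induced_def stratum_def)
  show ?thesis
  proof (rule isomorphismI)
    have "morphism (BEM G B Par Y Q) ?A' (delete_components P)"
      using morphism_compose[OF morphism_induced_inclusion m\<phi>] by (simp add: BEM_def comp_def)
    then show "morphism (induced (BEM G B Par Y Q) ?S) (BEM G B Par Y (flat P)) (delete_components P)"
      unfolding BEM_def[of G B Par Y "flat P"]
      by (rule morphism_induced_induced) (simp_all add: BEM_def restricting_induced \<phi>_image)
    have restr: "restricting ?A'" unfolding BEM_ambient_def by (rule restricting_product_variety)
    have "morphism (BEM G B Par Y (flat P)) (BEM G B Par Y Q) \<psi>"
      unfolding BEM_def by (rule morphism_induced_induced[OF m\<psi> restr]) (simp add: \<psi>_image)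
    then show "morphism (BEM G B Par Y (flat P)) (induced (BEM G B Par Y Q) ?S) \<psi>"
      unfolding BEM_def[of G B Par Y "flat P"]
      by (rule morphism_into_induced[OF _ restr]) (simp add: \<psi>_image)
  next
    fix x assume "x \<in> points (induced (BEM G B Par Y Q) ?S)"
    then have x: "x \<in> ?S" by (simp add: points_stratum)
    then have "x \<in> extensional {1..?N + 1}"
      by (auto simp: stratum_def points_BEM BEM_set_def BEM_ambient_def points_product_variety PiE_iff)
    then show "\<psi> (delete_components P x) = x"
      using \<sigma>\<tau>_stratum[OF x] \<tau>_range by (auto simp: \<psi>_def \<phi> fun_eq_iff extensional_def)
  next
    fix y assume "y \<in> points (BEM G B Par Y (flat P))"
    then have "y \<in> extensional {1..?M + 1}"
      by (auto simp: points_BEM BEM_set_def BEM_ambient_def points_product_variety PiE_iff)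
    then show "delete_components P (\<psi> y) = y"
      using \<tau>\<sigma> \<sigma>_range by (auto simp: \<psi>_def \<phi> fun_eq_iff extensional_def)
  qed
qed

theorem corollary3p8:
  fixes G B T K :: "(complex ^ 'n::finite ^ 'n) set"
    and \<theta> :: "complex ^ 'n ^ 'n \<Rightarrow> complex ^ 'n ^ 'n"
    and \<alpha> :: "nat \<Rightarrow> complex ^ 'n ^ 'n \<Rightarrow> complex"
    and r :: nat
    and Par :: "nat \<Rightarrow> (complex ^ 'n ^ 'n) set"
    and Y\<^sub>0 :: "(complex ^ 'n ^ 'n) set set"
    and Q :: "nat list"
  assumes "connected_reductive G"
    and "algebraic_involution G \<theta>"
    and "borel_subgroup G B" and "\<theta> ` B = B"
    and "maximal_torus G T" and "T \<subseteq> B" and "\<theta> ` T = T"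
    and "K = fixed_subgroup G \<theta>" and "connected_space (zar (var K))"
    and "bij_betw \<alpha> {1..r} (simple_roots B T)"
    and "\<And>i. i \<in> {1..r} \<Longrightarrow> Par i = minimal_parabolic G B T (\<alpha> i)"
    and "closed_orbit K G B Y\<^sub>0"
    and "set Q \<subseteq> {1..r}"
  shows "stratification_by_closed_subvarieties (BEM G B Par Y\<^sub>0 Q) (subwords Q) (stratum G B Par Y\<^sub>0 Q)
    \<and> (\<forall>P\<in>subwords Q.
         isomorphism (induced (BEM G B Par Y\<^sub>0 Q) (stratum G B Par Y\<^sub>0 Q P))
           (BEM G B Par Y\<^sub>0 (flat P)) (delete_components P))"
proof -
  have "subgroup G GL"
    using assms(1)
    by (simp add: connected_reductive_def connected_algebraic_group_def algebraic_group_def)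
  moreover have "algebraic_group B"
    using assms(3)
    by (simp add: borel_subgroup_def connected_solvable_subgroups_def connected_algebraic_group_def)
  ultimately show ?thesis
    using BEM_stratification stratum_isomorphism by blast
qed

end
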